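(* Let $R$ be a preparation map. Let $\hat\Delta_0$ be the linear map, multiplicative for the tree product, defined recursively by $\hat\Delta_0(\bullet)=\bullet\otimes\mathbf 1$ for $\bullet\in\{\mathbf 1,X_j,\Xi_i\}$ ($i\in\{0,1\}$, $j\in\{0,\dots,d\}$) and $$\hat\Delta_0(\mathcal I_a\tau)=(\mathcal I_a\otimes\mathrm{Id})\hat\Delta_0(\tau)-\sum_{\deg_1(\mathcal I_a\tau)\le|\ell|}\frac{X^\ell}{\ell!}\otimes\mathcal M^+\big(\mathcal I^{+,0}_{a+\ell}\otimes\mathrm{Id}\big)\hat\Delta_0(\tau).$$ Then, on $\mathcal T_1$, for every space-time point $x$, $$\Pi_x^{R,1}=\big(\Pi_x^{R,0}\otimes f_x^{R,0}\big)\hat\Delta_0 .$$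
   Context: **Trees.** Fix $d\ge 1$. For $k=(k_0,\dots,k_d)\in\mathbb N^{d+1}$ put $|k|=2k_0+k_1+\dots+k_d$ and $k!=\prod_jk_j!$. A decorated tree is a non-planar rooted tree with node decorations in $\mathbb N^{d+1}$ and edge decorations in $\{\mathcal I,\Xi_0,\Xi_1\}\times\mathbb N^{d+1}$. $T$ is the set of decorated trees, $\mathcal T$ its linear span. The tree product identifies the roots and adds their decorations; its unit $\mathbf 1$ is the single node decorated by $0$. $X^k$ is the single node decorated by $k$, $X_j=X^{e_j}$ ($j=0,\dots,d$); $\Xi_i$ is the tree with one edge, decorated by $(\Xi_i,0)$; $\mathcal I_a(\tau)$ grafts $\tau$ onto a new root (decorated $0$) via an edge decorated by $(\mathcal I,a)$ (a planted tree). Trees have the form $X^k\Xi_0^l\Xi_1^m\prod_{i}\mathcal I_{a_i}(\tau_i)$ with $l+m\le1$. $|\tau|_\Xi$ is the number of noises $\Xi_0,\Xi_1$ in $\tau$. **Degrees.** Let $\alpha\in\mathbb R$ be the space-time regularity of the noise $\xi$. Put $\deg_0(\Xi_0)=\deg_1(\Xi_0)=\deg_1(\Xi_1)=\alpha$, $\deg_0(\Xi_1)=\alpha+\frac{d+2}2$, and for $i=0,1$: $\deg_i(X^k)=|k|$, $\deg_i$ is additive for the tree product, $\deg_i(\mathcal I_a(\tau))=\deg_i(\tau)+2-|a|$. **Spaces.** $T_0\subset T$ is the set of trees (without $\Xi_1$) generated by a fixed normal complete rule associated with a subcritical singular SPDE $u=K*(F(u,\nabla u,\dots)\xi+G(u,\nabla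 u,\dots))$ on $\mathbb R_+\times\mathbb R^d$; $\mathcal T_0$ is its span, which is stable under the preparation map $R$ and under the coactions below. $T_1$ is the set of trees obtained from trees in $T_0$ by replacing at most one $\Xi_0$ by $\Xi_1$; $\mathcal T_1$ is its span. $\mathcal T^{+,i}$ is the algebra spanned by $X^k\prod_j\mathcal I^{+,i}_{a_j}(\tau_j)$ with $\tau_j\in T$, $\deg_i(\mathcal I_{a_j}(\tau_j))>0$; $\mathcal I^{+,i}_a$ is a new symbol, extended linearly, with $\mathcal I^{+,i}_a(\tau)=0$ if $\deg_i(\mathcal I_a(\tau))\le0$. $\mathcal T^+=\mathcal T^{+,0}$, and $\mathcal M^+$ is the multiplication on $\mathcal T^+$. The map $\hat\Delta_0$ takes values in $\mathcal T\otimes\mathcal T^+$. **Coactions.** $\Delta_i$ (with values in $\mathcal T\otimes\mathcal T^{+,i}$) is linear and multiplicative with $\Delta_i\mathbf 1=\mathbf 1\otimes\mathbf 1$, $\Delta_iX_j=X_j\otimes\mathbf 1+\mathbf 1\otimes X_j$, $\Delta_i\Xi_j=\Xi_j\otimes\mathbf 1$, $\Delta_i\mathcal I_a\tau=(\mathcal I_a\otimes\mathrm{Id})\Delta_i\tau+\sum_{|\ell+m|<\deg_i(\mathcal I_a\tau)}\frac{X^\ell}{\ell!}\otimes\frac{X^m}{m!}\mathcal I^{+,i}_{a+\ell+m}(\tau)$. **Malliavin derivative on trees.** $D_\Xi:\mathcal T_0\to\mathcal T_1$ is linear, satisfies the Leibniz rule for the tree product, and $D_\Xi\Xi_0=\Xi_1$,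 $D_\Xi X^k=0$, $D_\Xi\mathbf 1=0$, $D_\Xi\mathcal I_a(\tau)=\mathcal I_a(D_\Xi\tau)$. **Preparation map.** A linear map $R:\mathcal T\to\mathcal T$ fixing polynomials $X^k$, noises and planted trees such that: for each tree $\tau$, $R\tau=\tau+\sum_j\lambda_j\tau_j$ (finite sum) with $\deg_1(\tau_j)\ge\deg_1(\tau)$ and $|\tau_j|_\Xi<|\tau|_\Xi$; $(R\otimes\mathrm{Id})\Delta_i=\Delta_iR$ for $i=0,1$; and $RD_\Xi=D_\Xi R$ on $\mathcal T_0$. **Models.** $K$ is the compactly supported truncation of the kernel (heat kernel) of the SPDE, $\xi$ is the regularised (smooth) noise and $\delta\xi$ an infinitesimal (smooth) perturbation of it. For $i=0,1$, $\Pi_x^{R,i}\tau=\hat\Pi_x^{R,i}R\tau$, $\hat\Pi^{R,i}_x$ is multiplicative, $\hat\Pi_x^{R,i}X^k=(\cdot-x)^k$, $\hat\Pi_x^{R,i}\Xi_0=\xi$, $\hat\Pi_x^{R,i}\Xi_1=\delta\xi$, and $(\hat\Pi_x^{R,i}\mathcal I_a\tau)(y)=(D^aK*\Pi_x^{R,i}\tau)(y)-\sum_{|k|<\deg_i(\mathcal I_a\tau)}\frac{(y-x)^k}{k!}(D^{a+k}K*\Pi_x^{R,i}\tau)(x)$. The character $f_x^{R,i}:\mathcal T^{+,i}\to\mathbb R$ is given by $f_x^{R,i}(\mathbf 1)=1$, $f_x^{R,i}(X_j)=-x_j$, $f_x^{R,i}(\mathcal I_a^{+,i}(\tau))=-(D^aK*\Pi_x^{R,i}\tau)(x)$.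 *)

theory Defs
  imports "HOL-Analysis.Analysis" "HOL-Library.Poly_Mapping" "HOL-Library.Multiset"
begin

section \<open>Free vector spaces and tensor products\<close>

text \<open>
  The real vector space freely generated by a type \<open>'a\<close> is \<open>'a \<Rightarrow>\<^sub>0 real\<close>. If \<open>'a\<close> is a
  commutative monoid, written additively, then the multiplication of \<open>'a \<Rightarrow>\<^sub>0 real\<close> provided by
  the library is the bilinear extension of the monoid operation. The tensor product of two such
  spaces (or algebras) is the free vector space (algebra) over the product of the bases.
\<close>

instantiation poly_mapping :: (type, real_vector) real_vector
begin

definition scaleR_poly_mapping :: "real \<Rightarrow> ('a \<Rightarrow>\<^sub>0 'b) \<Rightarrow> 'a \<Rightarrow>\<^sub>0 'b" where
  "scaleR_poly_mapping c p = Poly_Mapping.map (scaleR c) p"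

lemma lookup_scaleR: "Poly_Mapping.lookup (c *\<^sub>R p) a = c *\<^sub>R Poly_Mapping.lookup p a" for p :: "'a \<Rightarrow>\<^sub>0 'b"
  unfolding scaleR_poly_mapping_def by (simp add: Poly_Mapping.map.rep_eq when_def)

instance
  by standard (auto intro!: poly_mapping_eqI simp: lookup_scaleR lookup_add scaleR_add_right scaleR_add_left)

end

abbreviation bas :: "'a \<Rightarrow> 'a \<Rightarrow>\<^sub>0 real" where
  "bas a \<equiv> Poly_Mapping.single a 1"

definition lin_ext :: "('a \<Rightarrow> 'b::real_vector) \<Rightarrow> ('a \<Rightarrow>\<^sub>0 real) \<Rightarrow> 'b" where
  "lin_ext f p = (\<Sum>a\<in>Poly_Mapping.keys p. Poly_Mapping.lookup p a *\<^sub>R f a)"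

definition tensor :: "('a \<Rightarrow>\<^sub>0 real) \<Rightarrow> ('b \<Rightarrow>\<^sub>0 real) \<Rightarrow> ('a \<times> 'b) \<Rightarrow>\<^sub>0 real" where
  "tensor p q = lin_ext (\<lambda>a. lin_ext (\<lambda>b. bas (a, b)) q) p"

definition tensor_map ::
    "(('a \<Rightarrow>\<^sub>0 real) \<Rightarrow> ('c \<Rightarrow>\<^sub>0 real)) \<Rightarrow> (('b \<Rightarrow>\<^sub>0 real) \<Rightarrow> ('e \<Rightarrow>\<^sub>0 real))
      \<Rightarrow> (('a \<times> 'b) \<Rightarrow>\<^sub>0 real) \<Rightarrow> ('c \<times> 'e) \<Rightarrow>\<^sub>0 real" where
  "tensor_map f g = lin_ext (\<lambda>(a, b). tensor (f (bas a)) (g (bas b)))"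

lemma lin_ext_superset:
  "finite A \<Longrightarrow> Poly_Mapping.keys p \<subseteq> A \<Longrightarrow> lin_ext f p = (\<Sum>a\<in>A. Poly_Mapping.lookup p a *\<^sub>R f a)"
  unfolding lin_ext_def
  by (rule sum.mono_neutral_left) (auto simp: in_keys_iff)

lemma lin_ext_bas [simp]: "lin_ext f (bas a) = f a"
  by (simp add: lin_ext_def)

lemma linear_lin_ext: "linear (lin_ext f)"
proof (rule linearI)
  fix p q :: "'a \<Rightarrow>\<^sub>0 real" and c :: real
  let ?A = "Poly_Mapping.keys p \<union> Poly_Mapping.keys q"
  have "lin_ext f (p + q) = (\<Sum>a\<in>?A. Poly_Mapping.lookup (p + q) a *\<^sub>R f a)"
    by (rule lin_ext_superset) (simp_all add: Poly_Mapping.keys_add)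
  also have "\<dots> = (\<Sum>a\<in>?A. Poly_Mapping.lookup p a *\<^sub>R f a) + (\<Sum>a\<in>?A. Poly_Mapping.lookup q a *\<^sub>R f a)"
    by (simp add: lookup_add scaleR_add_left sum.distrib)
  also have "\<dots> = lin_ext f p + lin_ext f q"
    by (simp add: lin_ext_superset[of ?A])
  finally show "lin_ext f (p + q) = lin_ext f p + lin_ext f q" .
  have "lin_ext f (c *\<^sub>R p) = (\<Sum>a\<in>Poly_Mapping.keys p. Poly_Mapping.lookup (c *\<^sub>R p) a *\<^sub>R f a)"
    by (rule lin_ext_superset) (auto simp: lookup_scaleR in_keys_iff)
  then show "lin_ext f (c *\<^sub>R p) = c *\<^sub>R lin_ext f p"
    by (simp add: lookup_scaleR lin_ext_def scaleR_sum_right)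
qed


section \<open>Multi-indices and space-time\<close>

text \<open>
  The spatial dimension is \<open>d = CARD('d)\<close>. Coordinates \<open>0, \<dots>, d\<close> are indexed by \<open>'d option\<close>, with
  \<open>None\<close> the time coordinate.
\<close>

type_synonym 'd midx = "nat ^ 'd option"
type_synonym 'd point = "real \<times> (real ^ 'd)"

definition mabs :: "'d::finite midx \<Rightarrow> nat" where
  "mabs k = 2 * k $ None + (\<Sum>j\<in>UNIV. k $ Some j)"

definition mfact :: "'d::finite midx \<Rightarrow> real" where
  "mfact k = (\<Prod>j\<in>UNIV. fact (k $ j))"

definition coord :: "'d::finite point \<Rightarrow> 'd option \<Rightarrow> real" where
  "coord z j = (case j of None \<Rightarrow> fst z | Some i \<Rightarrow> snd z $ i)"

definition unit_vec :: "'d::finite option \<Rightarrow> 'd point" where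
  "unit_vec j = (case j of None \<Rightarrow> (1, 0) | Some i \<Rightarrow> (0, axis i 1))"

definition mpow :: "'d::finite point \<Rightarrow> 'd midx \<Rightarrow> real" where
  "mpow z k = (\<Prod>j\<in>UNIV. coord z j ^ (k $ j))"

definition partial :: "'d::finite option \<Rightarrow> ('d point \<Rightarrow> real) \<Rightarrow> 'd point \<Rightarrow> real" where
  "partial j g y = deriv (\<lambda>t. g (y + t *\<^sub>R unit_vec j)) 0"

definition partials :: "'d::finite option list \<Rightarrow> ('d point \<Rightarrow> real) \<Rightarrow> 'd point \<Rightarrow> real" where
  "partials js g = foldr partial js g"

definition smooth_on :: "'d::finite point set \<Rightarrow> ('d point \<Rightarrow> real) \<Rightarrow> bool" where
  "smooth_on S g \<longleftrightarrow> (\<forall>js. \<forall>y\<in>S. partials js g differentiable (at y))"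

text \<open>The order of differentiation is irrelevant for the smooth functions considered below.\<close>

definition mderiv :: "'d::finite midx \<Rightarrow> ('d point \<Rightarrow> real) \<Rightarrow> 'd point \<Rightarrow> real" where
  "mderiv a g = partials (SOME js. \<forall>j. count_list js j = a $ j) g"

text \<open>
  \<open>D\<^sup>a K * g\<close> is the convolution of the distribution \<open>D\<^sup>a K\<close> with the smooth function \<open>g\<close>, i.e.
  \<open>y \<mapsto> \<langle>D\<^sup>a K, g (y - \<cdot>)\<rangle>\<close>. The sign of the distributional derivative cancels the one
  produced by the reflection. \<open>D\<^sup>a K\<close> itself is in general not locally integrable.
\<close>

definition dconv :: "'d::finite midx \<Rightarrow> ('d point \<Rightarrow> real) \<Rightarrow> ('d point \<Rightarrow> real) \<Rightarrow> 'd point \<Rightarrow> real" where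
  "dconv a K g y = (\<integral>z. K z * mderiv a g (y - z) \<partial>lborel)"

definition heat_kernel :: "'d::finite point \<Rightarrow> real" where
  "heat_kernel z =
    (if fst z > 0
     then (4 * pi * fst z) powr (- real CARD('d) / 2) * exp (- (norm (snd z))\<^sup>2 / (4 * fst z))
     else 0)"

definition truncated_heat_kernel :: "('d::finite point \<Rightarrow> real) \<Rightarrow> bool" where
  "truncated_heat_kernel K \<longleftrightarrow>
    (\<exists>C. compact C \<and> (\<forall>z. z \<notin> C \<longrightarrow> K z = 0)) \<and>
    (\<exists>r>0. \<forall>z\<in>ball 0 r. K z = heat_kernel z) \<and>
    smooth_on (- {0}) K"


section \<open>Decorated trees\<close>

datatype etype = EI | EXi0 | EXi1

datatype ('n, 'e) dtree = Node (root_dec: 'n) (branches: "('e \<times> ('n, 'e) dtree) multiset")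

type_synonym 'd edec = "etype \<times> 'd midx"
type_synonym 'd tree = "('d midx, 'd edec) dtree"

text \<open>
  The tree product is written \<open>+\<close> on trees, so that it becomes \<open>*\<close> on linear combinations of
  trees; its unit is \<open>0\<close>.
\<close>

instantiation dtree :: (comm_monoid_add, type) comm_monoid_add
begin

definition zero_dtree :: "('a, 'b) dtree" where
  "0 = Node 0 {#}"

definition plus_dtree :: "('a, 'b) dtree \<Rightarrow> ('a, 'b) dtree \<Rightarrow> ('a, 'b) dtree" where
  "\<sigma> + \<tau> = Node (root_dec \<sigma> + root_dec \<tau>) (branches \<sigma> + branches \<tau>)"

instance
  by standard (auto simp: zero_dtree_def plus_dtree_def add_ac intro: dtree.expand)

end

definition XT :: "'d::finite midx \<Rightarrow> 'd tree" where
  "XT k = Node k {#}"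

definition Xi0T :: "'d::finite tree" where
  "Xi0T = Node 0 {#((EXi0, 0), 0)#}"

definition Xi1T :: "'d::finite tree" where
  "Xi1T = Node 0 {#((EXi1, 0), 0)#}"

definition IT :: "'d::finite midx \<Rightarrow> 'd tree \<Rightarrow> 'd tree" where
  "IT a \<tau> = Node 0 {#((EI, a), \<tau>)#}"

inductive_set TT :: "'d::finite tree set" where
  "l + m \<le> (1::nat) \<Longrightarrow> (\<forall>p\<in>set_mset M. snd p \<in> TT) \<Longrightarrow>
    XT k + (\<Sum>_<l. Xi0T) + (\<Sum>_<m. Xi1T) + (\<Sum>p\<in>#M. IT (fst p) (snd p)) \<in> TT"

definition vspan :: "'a set \<Rightarrow> ('a \<Rightarrow>\<^sub>0 real) set" where
  "vspan S = span (bas ` S)"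

lemma size_branch: "p \<in># E \<Longrightarrow> size (snd p) < size (Node k E)"
  by (cases p) (auto dest!: multi_member_split)

text \<open>Needed for recursion through the branches of a tree.\<close>

lemmas image_mset_fundef_cong [fundef_cong] = image_mset_cong

function nnoise :: "'d::finite tree \<Rightarrow> nat" where
  "nnoise (Node k E) = (\<Sum>(e, \<sigma>)\<in>#E. (if fst e = EI then 0 else 1) + nnoise \<sigma>)"
  by pat_completeness auto
termination
  by (relation "Wellfounded.measure size") (auto dest: size_branch)

text \<open>
  \<open>deg \<alpha> i\<close> is the degree \<open>deg\<^sub>i\<close> for \<open>i = 0, 1\<close>.
\<close>

definition edge_deg :: "real \<Rightarrow> nat \<Rightarrow> 'd::finite itself \<Rightarrow> etype \<Rightarrow> real" where
  "edge_deg \<alpha> i _ t =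
    (case t of
      EI \<Rightarrow> 2
    | EXi0 \<Rightarrow> \<alpha>
    | EXi1 \<Rightarrow> (if i = 0 then \<alpha> + (real CARD('d) + 2) / 2 else \<alpha>))"

function deg :: "real \<Rightarrow> nat \<Rightarrow> 'd::finite tree \<Rightarrow> real" where
  "deg \<alpha> i (Node k E) =
    real (mabs k) + (\<Sum>(e, \<sigma>)\<in>#E. deg \<alpha> i \<sigma> + edge_deg \<alpha> i TYPE('d) (fst e) - real (mabs (snd e)))"
  by pat_completeness auto
termination
  by (relation "Wellfounded.measure (\<lambda>(\<alpha>, i, \<tau>). size \<tau>)") (auto dest: size_branch)


lemma deg_add: "deg \<alpha> i (\<sigma> + \<tau>) = deg \<alpha> i \<sigma> + deg \<alpha> i \<tau>"
  by (cases \<sigma>; cases \<tau>) (simp add: plus_dtree_def mabs_def sum.distrib)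

lemma deg_XT: "deg \<alpha> i (XT k) = real (mabs k)"
  by (simp add: XT_def)

lemma deg_0: "deg \<alpha> i 0 = 0"
  by (simp add: zero_dtree_def mabs_def)

lemma deg_Xi0T: "deg \<alpha> i Xi0T = \<alpha>"
  by (simp add: Xi0T_def deg_0 edge_deg_def mabs_def)

lemma deg_Xi1T:
  "deg \<alpha> 0 (Xi1T :: 'd::finite tree) = \<alpha> + (real CARD('d) + 2) / 2"
  "deg \<alpha> 1 (Xi1T :: 'd::finite tree) = \<alpha>"
  by (simp_all add: Xi1T_def deg_0 edge_deg_def mabs_def)

lemma deg_IT: "deg \<alpha> i (IT a \<tau>) = deg \<alpha> i \<tau> + 2 - real (mabs a)"
  by (simp add: IT_def edge_deg_def mabs_def)


section \<open>Coactions\<close>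

text \<open>
  The pair \<open>(k, M)\<close> stands for the monomial \<open>X\<^sup>k \<Prod>\<^sub>j \<I>\<^sup>+\<^bsub>a\<^sub>j\<^esub>(\<tau>\<^sub>j)\<close>, where \<open>M\<close> is the
  multiset of the \<open>(a\<^sub>j, \<tau>\<^sub>j)\<close>. The algebra \<open>\<T>\<^sup>+\<^sup>,\<^sup>i\<close> is the subalgebra of \<open>'d ptree \<Rightarrow>\<^sub>0 real\<close>
  generated by those monomials for which all \<open>\<tau>\<^sub>j\<close> belong to \<open>TT\<close> and all \<open>IT a\<^sub>j \<tau>\<^sub>j\<close> have
  positive \<open>i\<close>-degree; all maps below only produce such monomials from elements of \<open>TT\<close>.
\<close>

type_synonym 'd ptree = "'d midx \<times> ('d midx \<times> 'd tree) multiset"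

definition Iplus :: "real \<Rightarrow> nat \<Rightarrow> 'd::finite midx \<Rightarrow> ('d tree \<Rightarrow>\<^sub>0 real) \<Rightarrow> 'd ptree \<Rightarrow>\<^sub>0 real" where
  "Iplus \<alpha> i a = lin_ext (\<lambda>\<tau>. if deg \<alpha> i (IT a \<tau>) > 0 then bas (0, {#(a, \<tau>)#}) else 0)"

definition Mplus :: "(('d::finite ptree \<times> 'd ptree) \<Rightarrow>\<^sub>0 real) \<Rightarrow> 'd ptree \<Rightarrow>\<^sub>0 real" where
  "Mplus = lin_ext (\<lambda>(u, v). bas u * bas v)"

definition graft :: "'d::finite midx \<Rightarrow> ('d tree \<Rightarrow>\<^sub>0 real) \<Rightarrow> 'd tree \<Rightarrow>\<^sub>0 real" where
  "graft a = lin_ext (\<lambda>\<tau>. bas (IT a \<tau>))"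

definition XP :: "'d::finite midx \<Rightarrow> 'd ptree \<Rightarrow>\<^sub>0 real" where
  "XP k = bas (k, {#})"

text \<open>
  Multiplicative maps are given by their values on the powers of the \<open>X\<^sub>j\<close> and on the trees
  with a single edge at the root; a noise edge \<open>((t, a), \<sigma>)\<close> in an element of \<open>TT\<close> always has
  \<open>a = 0\<close> and \<open>\<sigma> = 0\<close>. The defining relations in their usual form are derived below.
\<close>

function coact_tree :: "real \<Rightarrow> nat \<Rightarrow> 'd::finite tree \<Rightarrow> ('d tree \<times> 'd ptree) \<Rightarrow>\<^sub>0 real" where
  "coact_tree \<alpha> i (Node k E) =
    (\<Prod>j\<in>UNIV. (tensor (bas (XT (axis j 1))) 1 + tensor 1 (XP (axis j 1))) ^ (k $ j)) *
    (\<Prod>(e, \<sigma>)\<in>#E.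
      if fst e = EI then
        tensor_map (graft (snd e)) id (coact_tree \<alpha> i \<sigma>) +
        (\<Sum>(l, m)\<in>{(l, m). real (mabs (l + m)) < deg \<alpha> i (IT (snd e) \<sigma>)}.
          tensor ((1 / mfact l) *\<^sub>R bas (XT l)) ((1 / mfact m) *\<^sub>R XP m * Iplus \<alpha> i (snd e + l + m) (bas \<sigma>)))
      else tensor (bas (Node 0 {#(e, \<sigma>)#})) 1)"
  by pat_completeness auto
termination
  by (relation "Wellfounded.measure (\<lambda>(\<alpha>, i, \<tau>). size \<tau>)") (auto dest: size_branch)

definition coact :: "real \<Rightarrow> nat \<Rightarrow> ('d::finite tree \<Rightarrow>\<^sub>0 real) \<Rightarrow> ('d tree \<times> 'd ptree) \<Rightarrow>\<^sub>0 real" where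
  "coact \<alpha> i = lin_ext (coact_tree \<alpha> i)"

text \<open>
  The formally infinite sum over \<open>l\<close> has only finitely many nonzero terms,
  cf. \<open>finite_support_hat\<close> below; \<open>Sum_any\<close> is the sum over these.
\<close>

function hat_coact_tree :: "real \<Rightarrow> 'd::finite tree \<Rightarrow> ('d tree \<times> 'd ptree) \<Rightarrow>\<^sub>0 real" where
  "hat_coact_tree \<alpha> (Node k E) =
    (\<Prod>j\<in>UNIV. tensor (bas (XT (axis j 1))) 1 ^ (k $ j)) *
    (\<Prod>(e, \<sigma>)\<in>#E.
      if fst e = EI then
        tensor_map (graft (snd e)) id (hat_coact_tree \<alpha> \<sigma>) -
        Sum_any (\<lambda>l. if deg \<alpha> 1 (IT (snd e) \<sigma>) \<le> real (mabs l)
          then tensor ((1 / mfact l) *\<^sub>R bas (XT l))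
                 (Mplus (tensor_map (Iplus \<alpha> 0 (snd e + l)) id (hat_coact_tree \<alpha> \<sigma>)))
          else 0)
      else tensor (bas (Node 0 {#(e, \<sigma>)#})) 1)"
  by pat_completeness auto
termination
  by (relation "Wellfounded.measure (\<lambda>(\<alpha>, \<tau>). size \<tau>)") (auto dest: size_branch)

definition hat_coact :: "real \<Rightarrow> ('d::finite tree \<Rightarrow>\<^sub>0 real) \<Rightarrow> ('d tree \<times> 'd ptree) \<Rightarrow>\<^sub>0 real" where
  "hat_coact \<alpha> = lin_ext (hat_coact_tree \<alpha>)"


lemma prod_axis_power: "(\<Prod>j\<in>UNIV. f j ^ (axis i (1::nat) $ j)) = (f i :: 'b::comm_monoid_mult)"
proof -
  have "(\<Prod>j\<in>UNIV. f j ^ (axis i (1::nat) $ j)) = (\<Prod>j\<in>UNIV. if j = i then f j else 1)"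
    by (intro prod.cong) (auto simp: axis_def)
  then show ?thesis by simp
qed

lemma tensor_one: "tensor (1 :: ('a::comm_monoid_add) \<Rightarrow>\<^sub>0 real) (1 :: ('b::comm_monoid_add) \<Rightarrow>\<^sub>0 real) = 1"
  by (simp add: tensor_def zero_prod_def flip: single_one)

lemma coact_tree_add: "coact_tree \<alpha> i (\<sigma> + \<tau>) = coact_tree \<alpha> i \<sigma> * coact_tree \<alpha> i \<tau>"
  by (cases \<sigma>; cases \<tau>) (simp add: plus_dtree_def power_add prod.distrib mult_ac)

lemma coact_tree_0: "coact_tree \<alpha> i 0 = 1"
  by (simp add: zero_dtree_def)

lemma coact_tree_X:
  "coact_tree \<alpha> i (XT (axis j 1)) = tensor (bas (XT (axis j 1))) 1 + tensor 1 (XP (axis j 1))"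
  by (simp add: XT_def prod_axis_power del: One_nat_def)

lemma coact_tree_noise:
  "coact_tree \<alpha> i Xi0T = tensor (bas Xi0T) 1"
  "coact_tree \<alpha> i Xi1T = tensor (bas Xi1T) 1"
  by (simp_all add: Xi0T_def Xi1T_def)

lemma coact_tree_IT:
  "coact_tree \<alpha> i (IT a \<tau>) =
    tensor_map (graft a) id (coact_tree \<alpha> i \<tau>) +
    (\<Sum>(l, m)\<in>{(l, m). real (mabs (l + m)) < deg \<alpha> i (IT a \<tau>)}.
      tensor ((1 / mfact l) *\<^sub>R bas (XT l)) ((1 / mfact m) *\<^sub>R XP m * Iplus \<alpha> i (a + l + m) (bas \<tau>)))"
  by (subst IT_def) simp

lemma hat_coact_tree_add: "hat_coact_tree \<alpha> (\<sigma> + \<tau>) = hat_coact_tree \<alpha> \<sigma> * hat_coact_tree \<alpha> \<tau>"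
  by (cases \<sigma>; cases \<tau>) (simp add: plus_dtree_def power_add prod.distrib mult_ac)

lemma hat_coact_tree_0: "hat_coact_tree \<alpha> 0 = tensor (bas 0) 1"
  by (subst zero_dtree_def) (simp add: tensor_one)

lemma hat_coact_tree_X: "hat_coact_tree \<alpha> (XT (axis j 1)) = tensor (bas (XT (axis j 1))) 1"
  by (simp add: XT_def prod_axis_power del: One_nat_def)

lemma hat_coact_tree_noise:
  "hat_coact_tree \<alpha> Xi0T = tensor (bas Xi0T) 1"
  "hat_coact_tree \<alpha> Xi1T = tensor (bas Xi1T) 1"
  by (simp_all add: Xi0T_def Xi1T_def)

lemma hat_coact_tree_IT:
  "hat_coact_tree \<alpha> (IT a \<tau>) =
    tensor_map (graft a) id (hat_coact_tree \<alpha> \<tau>) -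
    Sum_any (\<lambda>l. if deg \<alpha> 1 (IT a \<tau>) \<le> real (mabs l)
      then tensor ((1 / mfact l) *\<^sub>R bas (XT l))
             (Mplus (tensor_map (Iplus \<alpha> 0 (a + l)) id (hat_coact_tree \<alpha> \<tau>)))
      else 0)"
  by (subst IT_def) (simp cong: if_cong)

lemma finite_mabs_less: "finite {l :: 'd::finite midx. real (mabs l) < c}"
proof (rule finite_subset)
  show "{l :: 'd midx. real (mabs l) < c} \<subseteq> vec_lambda ` (UNIV \<rightarrow>\<^sub>E {..nat \<lceil>c\<rceil>})"
  proof
    fix l :: "'d midx" assume "l \<in> {l. real (mabs l) < c}"
    then have *: "real (mabs l) < c" by simp
    have "l $ j \<le> mabs l" for j
    proof (cases j)
      case (Some i)
      have "l $ Some i \<le> (\<Sum>j\<in>UNIV. l $ Some j)" by (rule member_le_sum) auto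
      then show ?thesis using Some by (simp add: mabs_def)
    qed (simp add: mabs_def)
    moreover have "mabs l \<le> nat \<lceil>c\<rceil>" using * by linarith
    ultimately have "l $ j \<le> nat \<lceil>c\<rceil>" for j using le_trans by blast
    then have "vec_nth l \<in> UNIV \<rightarrow>\<^sub>E {..nat \<lceil>c\<rceil>}" by auto
    then show "l \<in> vec_lambda ` (UNIV \<rightarrow>\<^sub>E {..nat \<lceil>c\<rceil>})"
      by (metis image_eqI vec_nth_inverse)
  qed
qed (intro finite_imageI finite_PiE, auto)

lemma finite_support_hat:
  fixes w :: "('d::finite tree \<times> 'd ptree) \<Rightarrow>\<^sub>0 real"
  shows "finite {l. (if Q l then tensor (c l *\<^sub>R bas (XT l)) (Mplus (tensor_map (Iplus \<alpha> 0 (a + l)) id w)) else 0) \<noteq> 0}"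
proof (rule finite_subset)
  let ?B = "\<Union>k\<in>Poly_Mapping.keys w. {l. real (mabs l) < deg \<alpha> 0 (IT a (fst k))}"
  show "finite ?B" by (auto intro: finite_mabs_less)
  show "{l. (if Q l then tensor (c l *\<^sub>R bas (XT l)) (Mplus (tensor_map (Iplus \<alpha> 0 (a + l)) id w)) else 0) \<noteq> 0} \<subseteq> ?B"
  proof (rule subsetI, rule ccontr)
    fix l
    assume l: "l \<in> {l. (if Q l then tensor (c l *\<^sub>R bas (XT l)) (Mplus (tensor_map (Iplus \<alpha> 0 (a + l)) id w)) else 0) \<noteq> 0}"
      and "l \<notin> ?B"
    then have ge: "deg \<alpha> 0 (IT a \<sigma>) \<le> real (mabs l)" if "(\<sigma>, u) \<in> Poly_Mapping.keys w" for \<sigma> u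
      using that by force
    have "mabs (a + l) = mabs a + mabs l" by (simp add: mabs_def sum.distrib)
    then have "Iplus \<alpha> 0 (a + l) (bas \<sigma>) = 0" if "(\<sigma>, u) \<in> Poly_Mapping.keys w" for \<sigma> u
      using ge[OF that] by (simp add: Iplus_def deg_IT)
    then have "tensor_map (Iplus \<alpha> 0 (a + l)) id w = 0"
      unfolding tensor_map_def lin_ext_def
      by (intro sum.neutral) (auto simp: tensor_def lin_ext_def)
    with l show False
      by (auto simp: Mplus_def tensor_def lin_ext_def split: if_splits)
  qed
qed


section \<open>Malliavin derivative\<close>

function malliavin_tree :: "'d::finite tree \<Rightarrow> 'd tree \<Rightarrow>\<^sub>0 real" where
  "malliavin_tree (Node k E) =
    (\<Sum>(e, \<sigma>)\<in>#E. bas (Node k (E - {#(e, \<sigma>)#})) *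
      (case fst e of
        EI \<Rightarrow> graft (snd e) (malliavin_tree \<sigma>)
      | EXi0 \<Rightarrow> bas (Node 0 {#((EXi1, snd e), \<sigma>)#})
      | EXi1 \<Rightarrow> 0))"
  by pat_completeness auto
termination
  by (relation "Wellfounded.measure size") (auto dest: size_branch)

definition malliavin :: "('d::finite tree \<Rightarrow>\<^sub>0 real) \<Rightarrow> 'd tree \<Rightarrow>\<^sub>0 real" where
  "malliavin = lin_ext malliavin_tree"


lemma malliavin_tree_add:
  "malliavin_tree (\<sigma> + \<tau>) = malliavin_tree \<sigma> * bas \<tau> + bas \<sigma> * malliavin_tree \<tau>"
proof -
  obtain k E where \<sigma>: "\<sigma> = Node k E" by (cases \<sigma>)
  obtain l F where \<tau>: "\<tau> = Node l F" by (cases \<tau>)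
  define D where "D = (\<lambda>(e, \<sigma>). case fst e of
        EI \<Rightarrow> graft (snd e) (malliavin_tree \<sigma>)
      | EXi0 \<Rightarrow> bas (Node 0 {#((EXi1, snd e), \<sigma>)#})
      | EXi1 \<Rightarrow> (0 :: 'a tree \<Rightarrow>\<^sub>0 real))"
  have M: "malliavin_tree (Node k E) = (\<Sum>p\<in>#E. bas (Node k (E - {#p#})) * D p)" for k E
    by (auto simp: D_def case_prod_unfold intro!: arg_cong[where f = sum_mset] image_mset_cong)
  have "(\<Sum>p\<in>#E. bas (Node (k + l) (E + F - {#p#})) * D p) =
      (\<Sum>p\<in>#E. bas (Node k (E - {#p#})) * D p) * bas (Node l F)"
    unfolding sum_mset_distrib_right
    by (intro arg_cong[where f = sum_mset] image_mset_cong)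
      (auto simp: mult_single plus_dtree_def add_ac mult.assoc mult.commute[of _ "D _"] dest!: multi_member_split)
  moreover have "(\<Sum>p\<in>#F. bas (Node (k + l) (E + F - {#p#})) * D p) =
      bas (Node k E) * (\<Sum>p\<in>#F. bas (Node l (F - {#p#})) * D p)"
    unfolding sum_mset_distrib_left
    by (intro arg_cong[where f = sum_mset] image_mset_cong)
      (auto simp: mult_single plus_dtree_def simp flip: mult.assoc dest!: multi_member_split)
  ultimately show ?thesis
    by (simp add: \<sigma> \<tau> plus_dtree_def M del: malliavin_tree.simps)
qed

lemma malliavin_tree_gens:
  "malliavin_tree (XT k) = 0"
  "malliavin_tree Xi0T = bas Xi1T"
  "malliavin_tree (IT a \<tau>) = graft a (malliavin_tree \<tau>)"
  by (simp_all add: XT_def Xi0T_def Xi1T_def IT_def single_one flip: zero_dtree_def)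


section \<open>Rules and the trees they generate\<close>

text \<open>
  A rule assigns to each edge type the admissible multisets of decorated edges leaving the upper
  end of an edge of that type. For the equation \<open>u = K * (F \<xi> + G)\<close>, a node carries at most one
  noise, the noise is not differentiated, and nothing grows on a noise edge.
\<close>

type_synonym 'd rule = "etype \<Rightarrow> 'd edec multiset set"

definition spde_rule :: "'d::finite rule \<Rightarrow> bool" where
  "spde_rule rl \<longleftrightarrow>
    rl EXi0 = {{#}} \<and> rl EXi1 = {{#}} \<and>
    (\<forall>N\<in>rl EI. (\<forall>(t, a)\<in>#N. t = EI \<or> t = EXi0 \<and> a = 0) \<and>
      size (filter_mset (\<lambda>(t, a). t = EXi0) N) \<le> 1)"

definition normal_rule :: "'d::finite rule \<Rightarrow> bool" where
  "normal_rule rl \<longleftrightarrow> (\<forall>t. rl t \<noteq> {} \<and> (\<forall>N\<in>rl t. \<forall>M. M \<subseteq># N \<longrightarrow> M \<in> rl t))"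

definition subcritical_rule :: "real \<Rightarrow> 'd::finite rule \<Rightarrow> bool" where
  "subcritical_rule \<alpha> rl \<longleftrightarrow>
    (\<exists>reg. \<forall>t\<in>{EI, EXi0}.
      ereal (reg t) < ereal (edge_deg \<alpha> 0 TYPE('d) t) +
        (INF N\<in>rl t. ereal (\<Sum>(s, a)\<in>#N. reg s - real (mabs a))))"

inductive conforms :: "'d::finite rule \<Rightarrow> etype \<Rightarrow> 'd tree \<Rightarrow> bool" for rl where
  "image_mset fst E \<in> rl t \<Longrightarrow> (\<forall>p\<in>#E. conforms rl (fst (fst p)) (snd p)) \<Longrightarrow> conforms rl t (Node k E)"

definition T0_of :: "'d::finite rule \<Rightarrow> 'd tree set" where
  "T0_of rl = {\<tau>\<in>TT. \<exists>t. conforms rl t \<tau>}"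

text \<open>
  Completeness expresses that contracting a subtree of negative degree to a single node does
  not lead out of the trees generated by the rule. In \<open>contracts rl t \<tau> N\<close>, the tree \<open>\<tau>\<close> sits
  on an edge of type \<open>t\<close> inside a larger tree; \<open>M\<close> consists of the edges of the larger tree
  that leave \<open>\<tau>\<close> at a given node of \<open>\<tau>\<close>, on which that node's decoration is distributed
  as derivatives; \<open>N\<close> collects all edges that leave the node to which \<open>\<tau>\<close> is contracted.
\<close>

inductive distributes :: "'d::finite midx \<Rightarrow> 'd edec multiset \<Rightarrow> 'd edec multiset \<Rightarrow> bool" where
  "distributes (\<Sum>(e, m)\<in>#P. m) (image_mset fst P) (image_mset (\<lambda>((t, a), m). (t, a + m)) P)"

inductive contracts :: "'d::finite rule \<Rightarrow> etype \<Rightarrow> 'd tree \<Rightarrow> 'd edec multiset \<Rightarrow> bool" for rl where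
  "E = image_mset (\<lambda>(e, \<sigma>, N). (e, \<sigma>)) F \<Longrightarrow>
   image_mset fst E + M \<in> rl t \<Longrightarrow>
   distributes k M M' \<Longrightarrow>
   (\<forall>p\<in>#F. contracts rl (fst (fst p)) (fst (snd p)) (snd (snd p))) \<Longrightarrow>
   contracts rl t (Node k E) (M' + (\<Sum>(e, \<sigma>, N)\<in>#F. N))"

definition complete_rule :: "real \<Rightarrow> 'd::finite rule \<Rightarrow> bool" where
  "complete_rule \<alpha> rl \<longleftrightarrow>
    (\<forall>t \<tau> N. \<tau> \<in> T0_of rl \<and> deg \<alpha> 0 \<tau> < 0 \<and> root_dec \<tau> = 0 \<and> (\<nexists>a \<sigma>. \<tau> = IT a \<sigma>) \<and>
      contracts rl t \<tau> N \<longrightarrow> N \<in> rl t)"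

inductive replaces_noise :: "'d::finite tree \<Rightarrow> 'd tree \<Rightarrow> bool" where
  "replaces_noise (Node k (add_mset ((EXi0, a), \<sigma>) E)) (Node k (add_mset ((EXi1, a), \<sigma>) E))"
| "replaces_noise \<sigma> \<sigma>' \<Longrightarrow> replaces_noise (Node k (add_mset (e, \<sigma>) E)) (Node k (add_mset (e, \<sigma>') E))"

definition T1_of :: "'d::finite rule \<Rightarrow> 'd tree set" where
  "T1_of rl = T0_of rl \<union> {\<sigma>. \<exists>\<tau>\<in>T0_of rl. replaces_noise \<tau> \<sigma>}"


section \<open>Preparation maps and models\<close>

text \<open>Only the restriction of \<open>R\<close> to \<open>vspan TT\<close> matters.\<close>

definition preparation_map ::
    "real \<Rightarrow> 'd::finite rule \<Rightarrow> (('d tree \<Rightarrow>\<^sub>0 real) \<Rightarrow> 'd tree \<Rightarrow>\<^sub>0 real) \<Rightarrow> bool" where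
  "preparation_map \<alpha> rl R \<longleftrightarrow>
    linear R \<and>
    R ` vspan TT \<subseteq> vspan TT \<and>
    R ` vspan (T0_of rl) \<subseteq> vspan (T0_of rl) \<and>
    (\<forall>k. R (bas (XT k)) = bas (XT k)) \<and>
    R (bas Xi0T) = bas Xi0T \<and> R (bas Xi1T) = bas Xi1T \<and>
    (\<forall>a. \<forall>\<tau>\<in>TT. R (bas (IT a \<tau>)) = bas (IT a \<tau>)) \<and>
    (\<forall>\<tau>\<in>TT. R (bas \<tau>) - bas \<tau> \<in> vspan {\<sigma>\<in>TT. deg \<alpha> 1 \<sigma> \<ge> deg \<alpha> 1 \<tau> \<and> nnoise \<sigma> < nnoise \<tau>}) \<and>
    (\<forall>i\<in>{0, 1}. \<forall>v\<in>vspan TT. tensor_map R id (coact \<alpha> i v) = coact \<alpha> i (R v)) \<and>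
    (\<forall>v\<in>vspan (T0_of rl). R (malliavin v) = malliavin (R v))"

text \<open>
  \<open>P x\<close> is the map \<open>\<Pi>\<^sub>x\<close> with a hat, and \<open>P x \<circ> R\<close> the map \<open>\<Pi>\<^sub>x\<close>. The recursion determines
  \<open>P x\<close> on \<open>vspan TT\<close>.
\<close>

definition prepared_model ::
    "real \<Rightarrow> (('d::finite tree \<Rightarrow>\<^sub>0 real) \<Rightarrow> 'd tree \<Rightarrow>\<^sub>0 real) \<Rightarrow> ('d point \<Rightarrow> real) \<Rightarrow>
      ('d point \<Rightarrow> real) \<Rightarrow> ('d point \<Rightarrow> real) \<Rightarrow> nat \<Rightarrow>
      ('d point \<Rightarrow> ('d tree \<Rightarrow>\<^sub>0 real) \<Rightarrow> 'd point \<Rightarrow> real) \<Rightarrow> bool" where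
  "prepared_model \<alpha> R K \<xi> \<delta>\<xi> i P \<longleftrightarrow>
    (\<forall>x.
      (\<forall>y. linear (\<lambda>v. P x v y)) \<and>
      (\<forall>\<sigma> \<tau>. \<sigma> + \<tau> \<in> TT \<longrightarrow> (\<forall>y. P x (bas (\<sigma> + \<tau>)) y = P x (bas \<sigma>) y * P x (bas \<tau>) y)) \<and>
      (\<forall>k y. P x (bas (XT k)) y = mpow (y - x) k) \<and>
      P x (bas Xi0T) = \<xi> \<and>
      P x (bas Xi1T) = \<delta>\<xi> \<and>
      (\<forall>a. \<forall>\<tau>\<in>TT. \<forall>y. P x (bas (IT a \<tau>)) y =
        dconv a K (P x (R (bas \<tau>))) y -
        (\<Sum>k\<in>{k. real (mabs k) < deg \<alpha> i (IT a \<tau>)}.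
          mpow (y - x) k / mfact k * dconv (a + k) K (P x (R (bas \<tau>))) x)))"

definition recentring_character ::
    "('d::finite point \<Rightarrow> real) \<Rightarrow> (('d tree \<Rightarrow>\<^sub>0 real) \<Rightarrow> 'd point \<Rightarrow> real) \<Rightarrow> 'd point \<Rightarrow>
      ('d ptree \<Rightarrow>\<^sub>0 real) \<Rightarrow> real" where
  "recentring_character K Q x =
    lin_ext (\<lambda>(k, M). mpow (- x) k * (\<Prod>(a, \<tau>)\<in>#M. - dconv a K (Q (bas \<tau>)) x))"

text \<open>\<open>p \<otimes> f\<close> for a map \<open>p\<close> into functions and a linear form \<open>f\<close>.\<close>

definition tensor_eval ::
    "(('a \<Rightarrow>\<^sub>0 real) \<Rightarrow> 'z \<Rightarrow> real) \<Rightarrow> (('b \<Rightarrow>\<^sub>0 real) \<Rightarrow> real) \<Rightarrow> (('a \<times> 'b) \<Rightarrow>\<^sub>0 real) \<Rightarrow> 'z \<Rightarrow> real" where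
  "tensor_eval p f v y = lin_ext (\<lambda>(a, b). p (bas a) y * f (bas b)) v"

end

theory Submission
  imports Defs "HOL-Probability.Distributions"
begin

text \<open>
  Fix \<open>x\<close>. Let \<open>\<Gamma>\<^sub>i = (Id \<otimes> f\<^sub>x\<^sup>i) \<Delta>\<^sub>i\<close> for the characters \<open>f\<^sub>x\<^sup>i\<close> of the two models, and let
  \<open>S = (Id \<otimes> f\<^sub>x\<^sup>0) \<Delta>\<close> with \<open>\<Delta>\<close> the map \<open>hat_coact\<close>. In these terms the claim reads
  \<open>P1 x R = P0 x R S\<close>; the difficulty is that \<open>S\<close> is not assumed to commute with \<open>R\<close>. One proves
  \<open>P1 x = P0 x S\<close> together with \<open>\<Gamma>\<^sub>0 S = \<Gamma>\<^sub>1\<close>, simultaneously for all trees, by induction on the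
  number of noises and then on the size. Since both \<open>\<Gamma>\<^sub>i\<close> commute with \<open>R\<close>, the second identity gives
  \<open>\<Gamma>\<^sub>0 (S R - R S) = 0\<close>, and \<open>\<Gamma>\<^sub>0\<close> is injective because it is the identity up to terms of lower
  degree. The induction step for planted trees compares Taylor cut-offs and uses that convolution
  with \<open>K\<close> acts linearly on the smooth functions.
\<close>


section \<open>Linear combinations\<close>

text \<open>The two identities feed each other. \<open>R\<close> turns \<tau> into \<tau> plus trees
  with fewer noises, and the recursion at \<open>IT a \<tau>\<close> sees only
  \<open>R (bas \<tau>)\<close>. The first identity there thus needs S and \<open>R\<close> to
  commute at \<tau>, which the second identity supplies. Conversely, the second identity at
  \<open>IT a \<tau>\<close> needs the character of the second model on planted trees to be that of
  the first composed with S, and this is the first identity put under the convolution. The induction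
  runs over all of \<open>TT\<close>, whose span is stable under both \<open>R\<close> and S. The
  analytic part exists because \<open>deriv\<close> and the Bochner integral are total:
  \<open>dconv\<close> is additive only for functions whose iterated partials exist and whose
  integrals converge. Hence every model function must be shown smooth, which in turn requires
  convolution with a kernel singular at the origin to preserve smoothness, and that rests on the
  integrability of the kernel.\<close>

lemma lin_ext_self: "lin_ext bas v = v"
proof (rule poly_mapping_eqI)
  fix b
  have "Poly_Mapping.lookup (lin_ext bas v) b =
      (\<Sum>a\<in>Poly_Mapping.keys v. Poly_Mapping.lookup v a * Poly_Mapping.lookup (bas a) b)"
    by (simp add: lin_ext_def lookup_sum lookup_scaleR)
  also have "\<dots> = (\<Sum>a\<in>Poly_Mapping.keys v. if a = b then Poly_Mapping.lookup v a else 0)"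
    by (intro sum.cong) (auto simp: lookup_single when_def)
  also have "\<dots> = Poly_Mapping.lookup v b"
    by (simp add: in_keys_iff)
  finally show "Poly_Mapping.lookup (lin_ext bas v) b = Poly_Mapping.lookup v b" .
qed

lemma lin_ext_compose: "linear g \<Longrightarrow> g (lin_ext f v) = lin_ext (\<lambda>a. g (f a)) v"
  by (simp add: lin_ext_def linear_sum linear_cmul)

lemma linear_eq_lin_ext: "linear f \<Longrightarrow> f v = lin_ext (\<lambda>a. f (bas a)) v"
  using lin_ext_compose[of f bas v] by (simp add: lin_ext_self)

lemma linear_eq_on_bas: "linear f \<Longrightarrow> linear g \<Longrightarrow> (\<And>a. f (bas a) = g (bas a)) \<Longrightarrow> f v = g v"
  using linear_eq_lin_ext[of f v] linear_eq_lin_ext[of g v] by simp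

lemma lin_ext_cong:
  "v = w \<Longrightarrow> (\<And>a. a \<in> Poly_Mapping.keys w \<Longrightarrow> f a = g a) \<Longrightarrow> lin_ext f v = lin_ext g w"
  by (simp add: lin_ext_def)

lemma lin_ext_plus: "lin_ext f (v + w) = lin_ext f v + lin_ext f w"
  by (rule linear_add[OF linear_lin_ext])

lemma lin_ext_scaleR: "lin_ext f (c *\<^sub>R v) = c *\<^sub>R lin_ext f v"
  by (rule linear_cmul[OF linear_lin_ext])

lemma lin_ext_zero: "lin_ext f 0 = 0"
  by (rule linear_0[OF linear_lin_ext])

lemma lin_ext_fun_add: "lin_ext (\<lambda>a. f a + g a) v = lin_ext f v + lin_ext g v"
  by (simp add: lin_ext_def scaleR_add_right sum.distrib)

lemma lin_ext_fun_uminus: "lin_ext (\<lambda>a. - f a) v = - lin_ext f v"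
  by (simp add: lin_ext_def sum_negf)

lemma lin_ext_fun_diff: "lin_ext (\<lambda>a. f a - g a) v = lin_ext f v - lin_ext g v"
  by (simp add: lin_ext_def scaleR_diff_right sum_subtractf)

lemma lin_ext_fun_scaleR: "lin_ext (\<lambda>a. c *\<^sub>R f a) v = c *\<^sub>R lin_ext f v"
  by (simp add: lin_ext_def scaleR_sum_right mult.commute)

lemma lin_ext_fun_scaleR_left: "lin_ext (\<lambda>a. f a *\<^sub>R c) v = lin_ext f v *\<^sub>R c"
  by (simp add: lin_ext_def scaleR_sum_left)

lemma lin_ext_fun_sum: "lin_ext (\<lambda>a. \<Sum>b\<in>B. f b a) v = (\<Sum>b\<in>B. lin_ext (f b) v)"
  unfolding lin_ext_def scaleR_sum_right by (rule sum.swap)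

lemma lin_ext_fun_zero: "lin_ext (\<lambda>a. 0) v = 0"
  by (simp add: lin_ext_def)

lemma linear_comp: "linear f \<Longrightarrow> linear g \<Longrightarrow> linear (\<lambda>v. g (f v))"
  using linear_compose[of f g] by (simp add: o_def)

lemma linear_scaleR_const: "linear f \<Longrightarrow> linear (\<lambda>v. f v *\<^sub>R c)"
  by (rule linearI) (simp_all add: linear_add linear_cmul scaleR_add_left)

text \<open>Membership in a span of basis vectors becomes a condition on the support, so that all
  bounds on degrees and noises can be read off key by key.\<close>

lemma mem_vspan_iff: "v \<in> vspan S \<longleftrightarrow> Poly_Mapping.keys v \<subseteq> S"
proof
  assume "v \<in> vspan S"
  then have "v \<in> span (bas ` S)" by (simp add: vspan_def)
  then show "Poly_Mapping.keys v \<subseteq> S"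
  proof (induction rule: span_induct_alt)
    case (step c x y)
    have "Poly_Mapping.keys (c *\<^sub>R x) \<subseteq> Poly_Mapping.keys x"
      by (auto simp: in_keys_iff lookup_scaleR)
    with step show ?case
      using Poly_Mapping.keys_add[of "c *\<^sub>R x" y] by fastforce
  qed simp
next
  assume "Poly_Mapping.keys v \<subseteq> S"
  then show "v \<in> vspan S"
    unfolding vspan_def
    using span_sum[of "Poly_Mapping.keys v" "\<lambda>a. Poly_Mapping.lookup v a *\<^sub>R bas a" "bas ` S"] lin_ext_self[of v]
    by (force simp: lin_ext_def intro: span_scale span_base)
qed

lemma subspace_vspan: "subspace (vspan S)"
  by (simp add: vspan_def)

lemma bas_mem_vspan: "a \<in> S \<Longrightarrow> bas a \<in> vspan S"
  by (simp add: vspan_def span_base)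

lemma mem_vspan_mono: "v \<in> vspan S \<Longrightarrow> S \<subseteq> S' \<Longrightarrow> v \<in> vspan S'"
  by (auto simp: mem_vspan_iff)

lemma lin_ext_mem_subspace:
  "subspace U \<Longrightarrow> (\<And>a. a \<in> Poly_Mapping.keys v \<Longrightarrow> f a \<in> U) \<Longrightarrow> lin_ext f v \<in> U"
  by (simp add: lin_ext_def subspace_sum subspace_scale)

lemma linear_eq_on_vspan:
  assumes "linear f" "linear g" "\<And>a. a \<in> S \<Longrightarrow> f (bas a) = g (bas a)" "v \<in> vspan S"
  shows "f v = g v"
  using assms by (auto simp: vspan_def intro: linear_eq_on[of f g v "bas ` S"])

lemma linear_image_vspan:
  assumes "linear f" "subspace U" "\<And>a. a \<in> S \<Longrightarrow> f (bas a) \<in> U" "v \<in> vspan S"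
  shows "f v \<in> U"
  using lin_ext_mem_subspace[of U v "\<lambda>a. f (bas a)"] linear_eq_lin_ext[of f v] assms
  by (auto simp: mem_vspan_iff)

section \<open>Multiplication in the free algebra\<close>

lemma scaleR_eq_times: "c *\<^sub>R p = Poly_Mapping.single 0 c * p"
  for p :: "'a::monoid_add \<Rightarrow>\<^sub>0 real"
  unfolding scaleR_poly_mapping_def real_scaleR_def by (rule mult_map_scale_conv_mult)

lemma scaleR_times: "(c *\<^sub>R p) * q = c *\<^sub>R (p * q)" "p * (c *\<^sub>R q) = c *\<^sub>R (p * q)"
  for p :: "'a::comm_monoid_add \<Rightarrow>\<^sub>0 real"
  by (simp_all add: scaleR_eq_times mult_ac)

lemma linear_times_left: "linear (\<lambda>q. p * q)" for p :: "'a::comm_monoid_add \<Rightarrow>\<^sub>0 real"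
  by (rule linearI) (simp_all add: distrib_left scaleR_times)

lemma linear_times_right: "linear (\<lambda>p. p * q)" for q :: "'a::comm_monoid_add \<Rightarrow>\<^sub>0 real"
  by (rule linearI) (simp_all add: distrib_right scaleR_times)

lemma bas_times: "bas (a + b) = bas a * bas b"
  by (simp add: mult_single)

lemma bas_zero: "bas 0 = 1"
  by (rule single_one)

lemma bilinear_eq_on_bas:
  assumes "\<And>w. linear (\<lambda>v. f v w)" "\<And>v. linear (f v)" "\<And>w. linear (\<lambda>v. g v w)" "\<And>v. linear (g v)"
    and "\<And>a b. f (bas a) (bas b) = g (bas a) (bas b)"
  shows "f v w = g v w"
proof (rule linear_eq_on_bas[of "\<lambda>v. f v w" "\<lambda>v. g v w"])
  show "f (bas a) w = g (bas a) w" for a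
    by (rule linear_eq_on_bas[of "f (bas a)" "g (bas a)"]) (rule assms)+
qed (rule assms)+

text \<open>The target product is a parameter \<open>m\<close> because \<open>lin_ext\<close>
  presupposes only a vector space; it is used with the reals and with free algebras as
  targets.\<close>

lemma lin_ext_times:
  fixes p q :: "'a::comm_monoid_add \<Rightarrow>\<^sub>0 real"
  assumes mult: "\<And>w. linear (\<lambda>v. m v w)" "\<And>v. linear (m v)"
    and hom: "\<And>a b. f (a + b) = m (f a) (f b)"
  shows "lin_ext f (p * q) = m (lin_ext f p) (lin_ext f q)"
proof (rule bilinear_eq_on_bas[of "\<lambda>p q. lin_ext f (p * q)" "\<lambda>p q. m (lin_ext f p) (lin_ext f q)"])
  show "lin_ext f (bas a * bas b) = m (lin_ext f (bas a)) (lin_ext f (bas b))" for a b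
    by (simp flip: bas_times add: hom)
qed (intro linear_comp[OF linear_times_left linear_lin_ext] linear_comp[OF linear_times_right linear_lin_ext]
  linear_comp[OF linear_lin_ext mult(1)] linear_comp[OF linear_lin_ext mult(2)])+

lemma times_mem_vspan:
  fixes v w :: "'a::comm_monoid_add \<Rightarrow>\<^sub>0 real"
  assumes "v \<in> vspan S" "w \<in> vspan S'" and "\<And>a b. a \<in> S \<Longrightarrow> b \<in> S' \<Longrightarrow> a + b \<in> U"
  shows "v * w \<in> vspan U"
proof (rule linear_image_vspan[OF linear_times_left subspace_vspan _ assms(2)])
  fix b assume b: "b \<in> S'"
  show "v * bas b \<in> vspan U"
    by (rule linear_image_vspan[OF linear_times_right subspace_vspan _ assms(1)])
      (auto simp flip: bas_times intro!: bas_mem_vspan assms(3) b)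
qed

section \<open>Tensor products and evaluation of the second factor\<close>

lemma tensor_bas: "tensor (bas a) (bas b) = bas (a, b)"
  by (simp add: tensor_def)

lemma linear_tensor_left: "linear (\<lambda>p. tensor p q)"
  unfolding tensor_def by (rule linear_lin_ext)

lemma linear_tensor_right: "linear (tensor p)" for p :: "'a \<Rightarrow>\<^sub>0 real"
proof (rule linearI)
  show "tensor p (v + w) = tensor p v + tensor p w" for v w :: "'b \<Rightarrow>\<^sub>0 real"
    by (simp add: tensor_def lin_ext_plus lin_ext_fun_add)
  show "tensor p (c *\<^sub>R v) = c *\<^sub>R tensor p v" for v :: "'b \<Rightarrow>\<^sub>0 real" and c
    by (simp add: tensor_def lin_ext_scaleR lin_ext_fun_scaleR)
qed

text \<open>The partial evaluation \<open>Id \<otimes> F\<close>, for a linear form \<open>F\<close> given by its values on the basis.\<close>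

definition contract :: "('b \<Rightarrow> real) \<Rightarrow> ('a \<times> 'b \<Rightarrow>\<^sub>0 real) \<Rightarrow> 'a \<Rightarrow>\<^sub>0 real" where
  "contract F = lin_ext (\<lambda>(a, b). F b *\<^sub>R bas a)"

lemma linear_contract: "linear (contract F)"
  unfolding contract_def by (rule linear_lin_ext)

lemma contract_bas: "contract F (bas (a, b)) = F b *\<^sub>R bas a"
  by (simp add: contract_def)

lemma contract_tensor: "contract F (tensor p q) = lin_ext F q *\<^sub>R p"
proof (rule bilinear_eq_on_bas[of "\<lambda>p q. contract F (tensor p q)" "\<lambda>p q. lin_ext F q *\<^sub>R p"])
  show "linear (\<lambda>p. contract F (tensor p q))" for q
    by (rule linear_comp[OF linear_tensor_left linear_contract])
  show "linear (\<lambda>q. contract F (tensor p q))" for p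
    by (rule linear_comp[OF linear_tensor_right linear_contract])
  show "linear (\<lambda>p. lin_ext F q *\<^sub>R p)" for q :: "'b \<Rightarrow>\<^sub>0 real"
    by (rule linear_scale_self)
  show "linear (\<lambda>q. lin_ext F q *\<^sub>R p)" for p :: "'a \<Rightarrow>\<^sub>0 real"
    by (rule linear_scaleR_const[OF linear_lin_ext])
qed (simp add: tensor_bas contract_bas)

text \<open>The two factors do not interact. Through this, the intertwining of \<open>R\<close> with
  a coaction becomes commutation with the evaluated coaction, and \<open>graft\<close> comes out of
  the recursions.\<close>

lemma contract_tensor_map:
  assumes "linear g"
  shows "contract F (tensor_map g id w) = g (contract F w)"
proof -
  have "contract F (tensor_map g id w) = lin_ext (\<lambda>(a, b). F b *\<^sub>R g (bas a)) w"
    by (simp add: tensor_map_def lin_ext_compose[OF linear_contract] contract_tensor case_prod_unfold)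
  also have "\<dots> = g (contract F w)"
    unfolding contract_def lin_ext_compose[OF assms] case_prod_unfold linear_cmul[OF assms] ..
  finally show ?thesis .
qed

lemma lin_ext_contract: "lin_ext f (contract F w) = lin_ext (\<lambda>(a, b). F b *\<^sub>R f a) w"
  by (simp add: contract_def lin_ext_compose[OF linear_lin_ext] case_prod_unfold lin_ext_scaleR)

text \<open>Turns the pairing in the claim into the model applied to a single vector, so that the
  rest can be done with linear maps on trees.\<close>

lemma tensor_eval_eq_contract:
  assumes "\<And>y. linear (\<lambda>v. p v y)"
  shows "tensor_eval p (lin_ext F) w y = p (contract F w) y"
  using linear_eq_lin_ext[OF assms, of "contract F w" y]
  by (simp add: lin_ext_contract tensor_eval_def mult.commute)

lemma contract_times:
  fixes v w :: "'a::comm_monoid_add \<times> 'b::comm_monoid_add \<Rightarrow>\<^sub>0 real"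
  assumes "\<And>a b. F (a + b) = F a * F b"
  shows "contract F (v * w) = contract F v * contract F w"
  unfolding contract_def
  by (rule lin_ext_times[of "(*)", OF linear_times_right linear_times_left])
    (auto simp: assms bas_times scaleR_times mult.commute)

lemma contract_one: "F 0 = 1 \<Longrightarrow> contract F 1 = 1"
  using contract_bas[of F 0 0] by (simp add: bas_zero flip: zero_prod_def)


section \<open>Smooth functions\<close>

lemma smooth_onD: "smooth_on S g \<Longrightarrow> y \<in> S \<Longrightarrow> g differentiable (at y)"
  unfolding smooth_on_def by (drule spec[of _ "[]"]) (simp add: partials_def)

lemma smooth_differentiable: "smooth_on UNIV g \<Longrightarrow> g differentiable (at y)"
  by (simp add: smooth_onD)

lemma partials_Cons: "partials (j # js) g = partial j (partials js g)"
  by (simp add: partials_def)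

lemma smooth_partials: "smooth_on S g \<Longrightarrow> smooth_on S (partials js g)"
  unfolding smooth_on_def
proof (intro allI ballI)
  fix js' y assume "\<forall>js. \<forall>y\<in>S. partials js g differentiable at y" "y \<in> S"
  then have "partials (js' @ js) g differentiable at y" by blast
  then show "partials js' (partials js g) differentiable at y"
    by (simp add: partials_def)
qed

lemma smooth_partial: "smooth_on S g \<Longrightarrow> smooth_on S (partial j g)"
  using smooth_partials[of S g "[j]"] by (simp add: partials_def)

lemma smooth_mderiv: "smooth_on S g \<Longrightarrow> smooth_on S (mderiv a g)"
  by (simp add: mderiv_def smooth_partials)

text \<open>Smoothness is a greatest fixed point: a class of differentiable functions that is closed
  under \<open>partial\<close> contains all iterated partials of its members.\<close>

lemma smooth_coinduct:
  assumes "g \<in> F" and "\<And>h y. h \<in> F \<Longrightarrow> h differentiable (at y)" and "\<And>h j. h \<in> F \<Longrightarrow> partial j h \<in> F"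
  shows "smooth_on UNIV g"
proof -
  have "partials js g \<in> F" for js
    by (induction js) (auto simp: partials_def assms)
  then show ?thesis by (auto simp: smooth_on_def assms)
qed

lemma continuous_on_smooth: "smooth_on S g \<Longrightarrow> continuous_on S g"
  by (meson continuous_at_imp_continuous_on differentiable_imp_continuous_within smooth_onD)

section \<open>Partial derivatives and the total derivative\<close>

lemma coord_linear: "linear (\<lambda>v. coord v j)"
  by (cases j) (auto simp: coord_def intro!: linearI)

lemma abs_coord_le: "\<bar>coord v j\<bar> \<le> norm v"
proof (cases j)
  case None
  then show ?thesis using norm_fst_le[of "fst v" "snd v"] by (simp add: coord_def)
next
  case (Some i)
  then show ?thesis using norm_snd_le[of "snd v" "fst v"] component_le_norm_cart[of "snd v" i] by (simp add: coord_def)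
qed

lemma point_eq_sum_coord: "(\<Sum>j\<in>UNIV. coord v j *\<^sub>R unit_vec j) = v" for v :: "'d::finite point"
proof (rule prod_eqI)
  have UN: "(UNIV :: 'd option set) = insert None (range Some)" by (rule UNIV_option_conv)
  have "(\<Sum>j\<in>UNIV. coord v j *\<^sub>R unit_vec j) = (fst v, \<Sum>i\<in>UNIV. snd v $ i *\<^sub>R axis i 1)"
    unfolding UN by (simp add: sum.reindex coord_def unit_vec_def prod_eq_iff fst_sum snd_sum)
  moreover have "(\<Sum>i\<in>UNIV. snd v $ i *\<^sub>R axis i 1) = snd v"
    by (simp add: vec_eq_iff axis_def if_distrib[of "\<lambda>x. _ * x"] cong: if_cong)
  ultimately show "fst (\<Sum>j\<in>UNIV. coord v j *\<^sub>R unit_vec j) = fst v"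
    "snd (\<Sum>j\<in>UNIV. coord v j *\<^sub>R unit_vec j) = snd v" by simp_all
qed

lemma partial_eqI:
  assumes "(g has_derivative g') (at y)"
  shows "partial j g y = g' (unit_vec j)"
proof -
  have "((\<lambda>t. y + t *\<^sub>R unit_vec j) has_derivative (\<lambda>t. t *\<^sub>R unit_vec j)) (at 0)"
    by (auto intro!: derivative_eq_intros)
  then have "((\<lambda>t. g (y + t *\<^sub>R unit_vec j)) has_derivative (\<lambda>t. g' (t *\<^sub>R unit_vec j))) (at 0)"
    using has_derivative_compose[of "\<lambda>t. y + t *\<^sub>R unit_vec j" _ 0 UNIV g g'] assms by simp
  moreover have "(\<lambda>t. g' (t *\<^sub>R unit_vec j)) = (*) (g' (unit_vec j))"
    using linear_cmul[OF has_derivative_linear[OF assms]] by (auto simp: mult.commute)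
  ultimately show ?thesis
    unfolding partial_def by (intro DERIV_imp_deriv) (simp add: has_field_derivative_def)
qed

text \<open>A derivative is linear, hence determined by its values on the unit vectors, which are
  the partials. This gives the mean value estimate below an explicit derivative.\<close>

lemma has_derivative_partial:
  assumes "g differentiable (at y)"
  shows "(g has_derivative (\<lambda>v. \<Sum>j\<in>UNIV. coord v j * partial j g y)) (at y)"
proof -
  obtain g' where g': "(g has_derivative g') (at y)"
    using assms by (auto simp: differentiable_def)
  have "g' v = (\<Sum>j\<in>UNIV. coord v j * partial j g y)" for v
  proof -
    note lin = has_derivative_linear[OF g']
    have "g' v = g' (\<Sum>j\<in>UNIV. coord v j *\<^sub>R unit_vec j)"
      by (simp add: point_eq_sum_coord)
    also have "\<dots> = (\<Sum>j\<in>UNIV. coord v j * g' (unit_vec j))"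
      by (simp add: linear_sum[OF lin] linear_cmul[OF lin])
    finally show ?thesis by (simp add: partial_eqI[OF g'])
  qed
  then have "g' = (\<lambda>v. \<Sum>j\<in>UNIV. coord v j * partial j g y)" by (rule ext)
  with g' show ?thesis by simp
qed

lemma partial_add:
  assumes "g differentiable (at y)" "h differentiable (at y)"
  shows "partial j (\<lambda>y. g y + h y) y = partial j g y + partial j h y"
proof -
  obtain g' h' where d: "(g has_derivative g') (at y)" "(h has_derivative h') (at y)"
    using assms by (auto simp: differentiable_def)
  show ?thesis
    using partial_eqI[OF has_derivative_add[OF d]] by (simp add: partial_eqI[OF d(1)] partial_eqI[OF d(2)])
qed

lemma partial_mult:
  assumes "g differentiable (at y)" "h differentiable (at y)"
  shows "partial j (\<lambda>y. g y * h y) y = partial j g y * h y + g y * partial j h y"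
proof -
  obtain g' h' where d: "(g has_derivative g') (at y)" "(h has_derivative h') (at y)"
    using assms by (auto simp: differentiable_def)
  show ?thesis
    using partial_eqI[OF has_derivative_mult[OF d]] by (simp add: partial_eqI[OF d(1)] partial_eqI[OF d(2)])
qed

lemma partial_const: "partial j (\<lambda>y. c) y = 0"
  using partial_eqI[OF has_derivative_const] .

section \<open>Closure properties of smooth functions\<close>

lemma smooth_add:
  assumes "smooth_on UNIV g" "smooth_on UNIV h"
  shows "smooth_on UNIV (\<lambda>y. g y + h y)"
proof (rule smooth_coinduct)
  let ?F = "{\<lambda>y. g y + h y | g h. smooth_on UNIV g \<and> smooth_on UNIV h}"
  show "(\<lambda>y. g y + h y) \<in> ?F" using assms by blast
  fix f assume "f \<in> ?F"
  then obtain g h where f: "f = (\<lambda>y. g y + h y)" and s: "smooth_on UNIV g" "smooth_on UNIV h" by blast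
  show "f differentiable (at y)" for y
    unfolding f using s by (auto intro!: differentiable_add dest: smooth_onD)
  have "partial j f = (\<lambda>y. partial j g y + partial j h y)" for j
    unfolding f using s by (intro ext) (simp add: partial_add smooth_differentiable)
  then show "partial j f \<in> ?F" for j
    using s by (blast intro: smooth_partial)
qed

lemma smooth_const: "smooth_on UNIV (\<lambda>y. c)"
  by (rule smooth_coinduct[of _ "range (\<lambda>c y. c)"]) (auto simp: partial_const[abs_def])

text \<open>By the Leibniz rule products alone are not closed under \<open>partial\<close>; their
  finite sums are, which makes them a class suitable for \<open>smooth_coinduct\<close>.\<close>

inductive_set product_sums :: "('d::finite point \<Rightarrow> real) set" where
  "smooth_on UNIV g \<Longrightarrow> smooth_on UNIV h \<Longrightarrow> (\<lambda>y. g y * h y) \<in> product_sums"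
| "g \<in> product_sums \<Longrightarrow> h \<in> product_sums \<Longrightarrow> (\<lambda>y. g y + h y) \<in> product_sums"

lemma smooth_mult:
  assumes "smooth_on UNIV g" "smooth_on UNIV h"
  shows "smooth_on UNIV (\<lambda>y. g y * h y)"
proof (rule smooth_coinduct)
  show "(\<lambda>y. g y * h y) \<in> product_sums" using assms by (rule product_sums.intros)
  have *: "(\<forall>y. f differentiable (at y)) \<and> (\<forall>j. partial j f \<in> product_sums)"
    if "f \<in> product_sums" for f :: "'a point \<Rightarrow> real"
    using that
  proof induction
    case (1 g h)
    then have "partial j (\<lambda>y. g y * h y) = (\<lambda>y. partial j g y * h y + g y * partial j h y)" for j
      by (intro ext) (simp add: partial_mult smooth_differentiable)
    with 1 show ?case
      by (auto intro!: product_sums.intros smooth_partial differentiable_mult dest: smooth_onD)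
  next
    case (2 g h)
    then have "partial j (\<lambda>y. g y + h y) = (\<lambda>y. partial j g y + partial j h y)" for j
      by (intro ext partial_add; blast)
    with 2 show ?case
      by (auto intro!: product_sums.intros differentiable_add)
  qed
  show "f differentiable (at y)" if "f \<in> product_sums" for f :: "'a point \<Rightarrow> real" and y
    using *[OF that] by blast
  show "partial j f \<in> product_sums" if "f \<in> product_sums" for f :: "'a point \<Rightarrow> real" and j
    using *[OF that] by blast
qed

lemma smooth_scaleR: "smooth_on UNIV g \<Longrightarrow> smooth_on UNIV (\<lambda>y. c * g y)"
  by (intro smooth_mult smooth_const)

lemma smooth_diff: "smooth_on UNIV g \<Longrightarrow> smooth_on UNIV h \<Longrightarrow> smooth_on UNIV (\<lambda>y. g y - h y)"
  using smooth_add[OF _ smooth_scaleR[of h "-1"], of g] by simp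

lemma smooth_sum: "(\<And>a. a \<in> A \<Longrightarrow> smooth_on UNIV (g a)) \<Longrightarrow> smooth_on UNIV (\<lambda>y. \<Sum>a\<in>A. g a y)"
  by (induction A rule: infinite_finite_induct) (auto intro: smooth_const smooth_add)

lemma smooth_prod: "(\<And>a. a \<in> A \<Longrightarrow> smooth_on UNIV (g a)) \<Longrightarrow> smooth_on UNIV (\<lambda>y. \<Prod>a\<in>A. g a y)"
  by (induction A rule: infinite_finite_induct) (auto intro: smooth_const smooth_mult)

lemma smooth_power: "smooth_on UNIV g \<Longrightarrow> smooth_on UNIV (\<lambda>y. g y ^ n)"
  by (induction n) (auto intro: smooth_const smooth_mult)

lemma smooth_coord: "smooth_on UNIV (\<lambda>y. coord (y - x) i)"
proof (rule smooth_coinduct)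
  let ?F = "insert (\<lambda>y. coord (y - x) i) (range (\<lambda>c y. c))"
  have d: "((\<lambda>y. coord (y - x) i) has_derivative (\<lambda>v. coord v i)) (at y)" for y
    using bounded_linear.has_derivative[OF linear_conv_bounded_linear[THEN iffD1, OF coord_linear],
        OF has_derivative_diff[OF has_derivative_ident has_derivative_const]]
    by simp
  show "(\<lambda>y. coord (y - x) i) \<in> ?F" by simp
  show "f differentiable (at y)" if "f \<in> ?F" for f y
    using that differentiableI[OF d, of y] by auto
  have "partial j (\<lambda>y. coord (y - x) i) \<in> range (\<lambda>c y. c)" for j
    by (intro image_eqI[of _ _ "coord (unit_vec j) i"] ext) (simp_all add: partial_eqI[OF d])
  moreover have "partial j (\<lambda>y :: 'a point. c) \<in> range (\<lambda>c y. c)" for j c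
    by (intro image_eqI[of _ _ 0] ext) (simp_all add: partial_const)
  ultimately show "partial j f \<in> ?F" if "f \<in> ?F" for f j
    using that by blast
qed

lemma smooth_mpow: "smooth_on UNIV (\<lambda>y. mpow (y - x) k)"
  unfolding mpow_def by (intro smooth_prod smooth_power smooth_coord)

lemma partials_add:
  assumes "smooth_on UNIV g" "smooth_on UNIV h"
  shows "partials js (\<lambda>y. g y + h y) = (\<lambda>y. partials js g y + partials js h y)"
proof (induction js)
  case (Cons j js)
  then show ?case
    using assms by (intro ext) (simp add: partials_Cons partial_add smooth_differentiable smooth_partials)
qed (simp add: partials_def)

lemma partials_cmult:
  assumes "smooth_on UNIV g"
  shows "partials js (\<lambda>y. c * g y) = (\<lambda>y. c * partials js g y)"
proof (induction js)
  case (Cons j js)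
  then show ?case
    using assms
    by (intro ext) (simp add: partials_Cons partial_mult partial_const smooth_differentiable smooth_partials)
qed (simp add: partials_def)


section \<open>Convolution with a truncated heat kernel\<close>

text \<open>The kernel confines \<open>z\<close> to a compact set, where the continuous factor is
  bounded, so a multiple of \<open>K\<close> dominates.\<close>

lemma integrable_conv:
  fixes K \<phi> :: "'d::finite point \<Rightarrow> real"
  assumes K: "integrable lborel K" "compact C" "\<And>z. z \<notin> C \<Longrightarrow> K z = 0" and \<phi>: "continuous_on UNIV \<phi>"
  shows "integrable lborel (\<lambda>z. K z * \<phi> (y - z))"
proof -
  have c: "continuous_on A (\<lambda>z. \<phi> (y - z))" for A
    by (rule continuous_on_compose2[OF \<phi>]) (auto intro!: continuous_intros)
  then have "bounded ((\<lambda>z. \<phi> (y - z)) ` C)"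
    using compact_continuous_image compact_imp_bounded K(2) by blast
  then obtain M where M: "\<And>z. z \<in> C \<Longrightarrow> \<bar>\<phi> (y - z)\<bar> \<le> M" by (auto simp: bounded_iff)
  show ?thesis
  proof (rule Bochner_Integration.integrable_bound)
    show "integrable lborel (\<lambda>z. M * K z)" using K(1) by simp
    have "(\<lambda>z. \<phi> (y - z)) \<in> borel_measurable borel"
      using c by (rule borel_measurable_continuous_onI)
    then show "(\<lambda>z. K z * \<phi> (y - z)) \<in> borel_measurable lborel"
      using borel_measurable_integrable[OF K(1)] by simp
    show "AE z in lborel. norm (K z * \<phi> (y - z)) \<le> norm (M * K z)"
    proof (intro AE_I2)
      fix z
      show "norm (K z * \<phi> (y - z)) \<le> norm (M * K z)"
      proof (cases "z \<in> C")
        case True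
        then have "\<bar>\<phi> (y - z)\<bar> \<le> \<bar>M\<bar>" using M[OF True] by simp
        then show ?thesis by (simp add: abs_mult mult.commute[of "\<bar>M\<bar>"] mult_left_mono)
      qed (simp add: K)
    qed
  qed
qed

text \<open>Differentiation under the integral: the linearisation error of \<phi> is small uniformly
  in \<open>z \<in> C\<close>, and integrating it against the absolute value of \<open>K\<close>
  costs only the factor \<open>A\<close>.\<close>

lemma has_derivative_conv:
  fixes K \<phi> :: "'d::finite point \<Rightarrow> real"
  assumes K: "integrable lborel K" "compact C" "\<And>z. z \<notin> C \<Longrightarrow> K z = 0" and \<phi>: "smooth_on UNIV \<phi>"
  shows "((\<lambda>y. \<integral>z. K z * \<phi> (y - z) \<partial>lborel) has_derivative
    (\<lambda>v. \<Sum>j\<in>UNIV. coord v j * (\<integral>z. K z * partial j \<phi> (y - z) \<partial>lborel))) (at y)"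
  unfolding has_derivative_at_alt
proof (intro conjI allI impI)
  have "linear (\<lambda>v. coord v j * c)" for j :: "'d option" and c :: real
    using linear_scaleR_const[OF coord_linear, of j c] by simp
  then have "linear (\<lambda>v. \<Sum>j\<in>UNIV. coord v j * c j)" for c :: "'d option \<Rightarrow> real"
    by (intro linear_compose_sum ballI)
  then show "bounded_linear (\<lambda>v. \<Sum>j\<in>UNIV. coord v j * (\<integral>z. K z * partial j \<phi> (y - z) \<partial>lborel))"
    by (simp add: linear_conv_bounded_linear)
  note int = integrable_conv[OF K continuous_on_smooth]
  have cont: "continuous_on A (partial j \<phi>)" for A j
    using continuous_on_smooth[OF smooth_partial[OF \<phi>]] continuous_on_subset by blast
  fix e :: real assume "e > 0"
  define A where "A = (\<integral>z. \<bar>K z\<bar> \<partial>lborel)"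
  have "A \<ge> 0" by (simp add: A_def)
  define N where "N = real (card (UNIV :: 'd option set))"
  have "N > 0" unfolding N_def by (simp add: card_gt_0_iff)
  \<comment> \<open>Adding 1 keeps the quotient meaningful when \<open>A = 0\<close> and still gives
    \<open>A * \<epsilon> \<le> e\<close>. Below, \<epsilon> is shared equally among the
    \<open>N\<close> coordinates.\<close>
  define \<epsilon> where "\<epsilon> = e / (A + 1)"
  have "\<epsilon> > 0" using \<open>e > 0\<close> \<open>A \<ge> 0\<close> by (simp add: \<epsilon>_def)
  \<comment> \<open>A compact set containing every segment from \<open>y - z\<close> to
    \<open>y' - z\<close> with \<open>z \<in> C\<close> and \<open>y'\<close> within distance 1 of
    \<open>y\<close>. Uniform continuity of the partials on it yields one radius for all
    \<open>z\<close>; this is why \<delta> is capped at 1.\<close>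
  define S where "S = {y' - z | y' z. y' \<in> cball y 1 \<and> z \<in> C}"
  have "compact S" unfolding S_def by (intro compact_differences compact_cball K)
  have "\<exists>d>0. \<forall>w\<in>S. \<forall>w'\<in>S. dist w' w < d \<longrightarrow> \<bar>partial j \<phi> w' - partial j \<phi> w\<bar> < \<epsilon> / N" for j
    using compact_uniformly_continuous[OF cont \<open>compact S\<close>, of j] \<open>\<epsilon> > 0\<close> \<open>N > 0\<close>
    unfolding uniformly_continuous_on_def dist_real_def by (metis divide_pos_pos)
  then obtain d where d: "\<And>j. d j > 0"
    "\<And>j w w'. w \<in> S \<Longrightarrow> w' \<in> S \<Longrightarrow> dist w' w < d j \<Longrightarrow> \<bar>partial j \<phi> w' - partial j \<phi> w\<bar> < \<epsilon> / N"
    by metis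
  define \<delta> where "\<delta> = min 1 (Min (range d))"
  have \<delta>: "\<delta> > 0" "\<delta> \<le> 1" "\<And>j. \<delta> \<le> d j" using d(1) by (auto simp: \<delta>_def min_le_iff_disj)
  show "\<exists>d>0. \<forall>y'. norm (y' - y) < d \<longrightarrow>
    norm ((\<integral>z. K z * \<phi> (y' - z) \<partial>lborel) - (\<integral>z. K z * \<phi> (y - z) \<partial>lborel) -
      (\<Sum>j\<in>UNIV. coord (y' - y) j * (\<integral>z. K z * partial j \<phi> (y - z) \<partial>lborel))) \<le> e * norm (y' - y)"
  proof (intro exI[of _ \<delta>] conjI allI impI \<delta>)
    fix y' assume y': "norm (y' - y) < \<delta>"
    define E where "E z = \<phi> (y' - z) - \<phi> (y - z) - (\<Sum>j\<in>UNIV. coord (y' - y) j * partial j \<phi> (y - z))" for z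
    have E: "\<bar>E z\<bar> \<le> norm (y' - y) * \<epsilon>" if "z \<in> C" for z
    proof -
      let ?S = "closed_segment (y - z) (y' - z)"
      have S: "w \<in> S \<and> dist w (y - z) < \<delta>" if w: "w \<in> ?S" for w
      proof -
        obtain t where t: "w = (1 - t) *\<^sub>R (y - z) + t *\<^sub>R (y' - z)" "0 \<le> t" "t \<le> 1"
          using w unfolding in_segment by blast
        have w': "w = (y + t *\<^sub>R (y' - y)) - z" by (simp add: t algebra_simps)
        have "norm (t *\<^sub>R (y' - y)) \<le> norm (y' - y)" using t by (simp add: mult_left_le_one_le)
        then have "norm (t *\<^sub>R (y' - y)) < \<delta>" using y' by linarith
        then have "y + t *\<^sub>R (y' - y) \<in> cball y 1" "dist w (y - z) < \<delta>"
          using \<delta>(2) by (simp_all add: dist_norm w')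
        then show ?thesis
          unfolding S_def using w' \<open>z \<in> C\<close> by blast
      qed
      have "norm (\<phi> (y' - z) - \<phi> (y - z) - (\<Sum>j\<in>UNIV. coord ((y' - z) - (y - z)) j * partial j \<phi> (y - z)))
          \<le> norm ((y' - z) - (y - z)) * \<epsilon>"
      proof (rule differentiable_bound_linearization[where S = ?S
            and f' = "\<lambda>w v. \<Sum>j\<in>UNIV. coord v j * partial j \<phi> w"])
        show "(y - z) + t *\<^sub>R ((y' - z) - (y - z)) \<in> ?S" if "t \<in> {0..1}" for t
          using that by (auto simp: closed_segment_def algebra_simps intro!: exI[of _ t])
        show "(\<phi> has_derivative (\<lambda>v. \<Sum>j\<in>UNIV. coord v j * partial j \<phi> w)) (at w within ?S)" for w
          by (rule has_derivative_at_withinI[OF has_derivative_partial[OF smooth_onD[OF \<phi>]]]) simp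
        show "onorm ((\<lambda>v. \<Sum>j\<in>UNIV. coord v j * partial j \<phi> w) -
            (\<lambda>v. \<Sum>j\<in>UNIV. coord v j * partial j \<phi> (y - z))) \<le> \<epsilon>" if w: "w \<in> ?S" for w
        proof (rule onorm_bound)
          fix v
          have "norm (((\<lambda>v. \<Sum>j\<in>UNIV. coord v j * partial j \<phi> w) -
            (\<lambda>v. \<Sum>j\<in>UNIV. coord v j * partial j \<phi> (y - z))) v) =
            \<bar>\<Sum>j\<in>UNIV. coord v j * (partial j \<phi> w - partial j \<phi> (y - z))\<bar>"
            by (simp add: right_diff_distrib sum_subtractf)
          also have "\<dots> \<le> (\<Sum>j\<in>UNIV. \<bar>coord v j * (partial j \<phi> w - partial j \<phi> (y - z))\<bar>)"
            by (rule sum_abs)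
          also have "\<dots> \<le> (\<Sum>j\<in>(UNIV :: 'd option set). norm v * (\<epsilon> / N))"
          proof (rule sum_mono)
            fix j
            have "\<bar>partial j \<phi> w - partial j \<phi> (y - z)\<bar> < \<epsilon> / N"
              using S[OF w] S[of "y - z"] \<delta>(3)[of j] by (intro d) auto
            then show "\<bar>coord v j * (partial j \<phi> w - partial j \<phi> (y - z))\<bar> \<le> norm v * (\<epsilon> / N)"
              using abs_coord_le[of v j] unfolding abs_mult by (intro mult_mono) auto
          qed
          also have "\<dots> = \<epsilon> * norm v"
            using \<open>N > 0\<close> by (simp add: N_def)
          finally show "norm (((\<lambda>v. \<Sum>j\<in>UNIV. coord v j * partial j \<phi> w) -
            (\<lambda>v. \<Sum>j\<in>UNIV. coord v j * partial j \<phi> (y - z))) v) \<le> \<epsilon> * norm v" .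
        qed (use \<open>\<epsilon> > 0\<close> in simp)
      qed simp
      then show ?thesis by (simp add: E_def)
    qed
    have iE: "integrable lborel (\<lambda>z. K z * E z)"
      unfolding E_def right_diff_distrib sum_distrib_left mult.left_commute[of "K _" "coord _ _"]
      by (intro Bochner_Integration.integrable_diff Bochner_Integration.integrable_sum integrable_mult_right
          int smooth_partial \<phi>)
    have "(\<integral>z. K z * \<phi> (y' - z) \<partial>lborel) - (\<integral>z. K z * \<phi> (y - z) \<partial>lborel) -
      (\<Sum>j\<in>UNIV. coord (y' - y) j * (\<integral>z. K z * partial j \<phi> (y - z) \<partial>lborel)) = (\<integral>z. K z * E z \<partial>lborel)"
      unfolding E_def right_diff_distrib sum_distrib_left mult.left_commute[of "K _" "coord _ _"]
      by (simp add: int \<phi> smooth_partial)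
    also have "norm \<dots> \<le> (\<integral>z. \<bar>K z\<bar> * (norm (y' - y) * \<epsilon>) \<partial>lborel)"
    proof (rule order_trans[OF integral_norm_bound integral_mono])
      show "integrable lborel (\<lambda>z. norm (K z * E z))" using iE by (rule integrable_norm)
      show "integrable lborel (\<lambda>z. \<bar>K z\<bar> * (norm (y' - y) * \<epsilon>))" using K(1) by simp
      show "norm (K z * E z) \<le> \<bar>K z\<bar> * (norm (y' - y) * \<epsilon>)" for z
        using E[of z] K(3)[of z] by (cases "z \<in> C") (auto simp: abs_mult intro!: mult_left_mono)
    qed
    also have "\<dots> = (A * \<epsilon>) * norm (y' - y)" by (simp add: A_def)
    also have "\<dots> \<le> e * norm (y' - y)"
      using \<open>A \<ge> 0\<close> \<open>e > 0\<close> by (intro mult_right_mono) (auto simp: \<epsilon>_def field_simps)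
    finally show "norm ((\<integral>z. K z * \<phi> (y' - z) \<partial>lborel) - (\<integral>z. K z * \<phi> (y - z) \<partial>lborel) -
      (\<Sum>j\<in>UNIV. coord (y' - y) j * (\<integral>z. K z * partial j \<phi> (y - z) \<partial>lborel))) \<le> e * norm (y' - y)" .
  qed
qed

text \<open>All derivatives fall on \<phi>, so convolutions with smooth functions form a class
  closed under \<open>partial\<close>, however irregular \<open>K\<close> is.\<close>

lemma smooth_conv:
  fixes K \<phi> :: "'d::finite point \<Rightarrow> real"
  assumes K: "integrable lborel K" "compact C" "\<And>z. z \<notin> C \<Longrightarrow> K z = 0" and \<phi>: "smooth_on UNIV \<phi>"
  shows "smooth_on UNIV (\<lambda>y. \<integral>z. K z * \<phi> (y - z) \<partial>lborel)"
proof (rule smooth_coinduct)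
  let ?F = "{\<lambda>y. \<integral>z. K z * \<phi> (y - z) \<partial>lborel | \<phi>. smooth_on UNIV \<phi>}"
  show "(\<lambda>y. \<integral>z. K z * \<phi> (y - z) \<partial>lborel) \<in> ?F" using \<phi> by blast
  fix f assume "f \<in> ?F"
  then obtain \<phi> where f: "f = (\<lambda>y. \<integral>z. K z * \<phi> (y - z) \<partial>lborel)" and \<phi>: "smooth_on UNIV \<phi>" by blast
  note d = has_derivative_conv[OF K \<phi>]
  show "f differentiable (at y)" for y
    unfolding f by (rule differentiableI[OF d])
  fix j
  have delta: "coord (unit_vec j) i = (if i = j then 1 else 0)" for i :: "'d option"
    by (auto simp: coord_def unit_vec_def axis_def split: option.splits)
  have "partial j f = (\<lambda>y. \<integral>z. K z * partial j \<phi> (y - z) \<partial>lborel)"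
    unfolding f by (rule ext) (simp add: partial_eqI[OF d] delta if_distrib[of "\<lambda>x. x * _"] cong: if_cong)
  then show "partial j f \<in> ?F" using smooth_partial[OF \<phi>] by blast
qed

section \<open>Integrability of the truncated heat kernel\<close>

lemma heat_kernel_eq_prod:
  assumes "t > 0"
  shows "heat_kernel (t, x) = (\<Prod>b\<in>Basis. normal_density 0 (sqrt (2 * t)) (x \<bullet> b))"
proof -
  have "(norm x)\<^sup>2 = (\<Sum>b\<in>Basis. (x \<bullet> b)\<^sup>2)"
    by (simp add: norm_eq_sqrt_inner euclidean_inner[of x x] power2_eq_square sum_nonneg)
  then have "exp (- (norm x)\<^sup>2 / (4 * t)) = (\<Prod>b\<in>Basis. exp (- (x \<bullet> b)\<^sup>2 / (4 * t)))"
    by (simp add: exp_sum sum_divide_distrib flip: sum_negf)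
  moreover have "(4 * pi * t) powr (- real CARD('a) / 2) = (1 / sqrt (4 * pi * t)) ^ CARD('a)"
    using assms by (simp add: powr_minus_divide powr_half_sqrt_powr powr_realpow power_one_over real_sqrt_power)
  moreover have "DIM(real ^ 'a) = CARD('a)" by simp
  ultimately show ?thesis
    using assms by (simp add: heat_kernel_def normal_density_def prod.distrib mult.assoc power_one_over prod_dividef)
qed

text \<open>At a fixed positive time the kernel is a centred Gaussian with independent coordinates
  of variance \<open>2 * t\<close>, so its mass is a product of one-dimensional integrals.\<close>

lemma nn_integral_heat_kernel:
  assumes "t > 0"
  shows "(\<integral>\<^sup>+x. ennreal (heat_kernel (t, x :: real ^ 'd::finite)) \<partial>lborel) = 1"
proof -
  have "(\<integral>\<^sup>+x. ennreal (heat_kernel (t, x :: real ^ 'd)) \<partial>lborel) =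
      (\<integral>\<^sup>+(x :: real ^ 'd). (\<Prod>b\<in>Basis. ennreal (normal_density 0 (sqrt (2 * t)) (x \<bullet> b))) \<partial>lborel)"
    by (simp add: heat_kernel_eq_prod[OF assms] prod_ennreal)
  also have "\<dots> = (\<Prod>b\<in>(Basis :: (real ^ 'd) set). (\<integral>\<^sup>+x. ennreal (normal_density 0 (sqrt (2 * t)) x) \<partial>lborel))"
    by (rule nn_integral_lborel_prod) auto
  also have "(\<integral>\<^sup>+x. ennreal (normal_density 0 (sqrt (2 * t)) x) \<partial>lborel) = 1"
    using assms by (simp add: nn_integral_eq_integral)
  finally show ?thesis by simp
qed

lemma heat_kernel_measurable: "(heat_kernel :: 'a::finite point \<Rightarrow> real) \<in> borel_measurable borel"
proof -
  have [measurable]: "(fst :: 'a point \<Rightarrow> real) \<in> borel_measurable borel"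
    "(snd :: 'a point \<Rightarrow> real ^ 'a) \<in> borel_measurable borel"
    by (intro borel_measurable_continuous_onI continuous_intros)+
  show ?thesis unfolding heat_kernel_def by measurable
qed

text \<open>The singularity at the origin is that of the heat kernel, whose mass is 1 at each
  positive time and therefore finite over a bounded time interval. Off a ball around the origin,
  \<open>K\<close> is bounded with compact support.\<close>

lemma truncated_heat_kernel_integrable:
  fixes K :: "'d::finite point \<Rightarrow> real"
  assumes "truncated_heat_kernel K"
  shows "integrable lborel K"
proof -
  obtain C r where C: "compact C" "\<And>z. z \<notin> C \<Longrightarrow> K z = 0"
    and r: "r > 0" "\<And>z. z \<in> ball 0 r \<Longrightarrow> K z = heat_kernel z" and sm: "smooth_on (- {0}) K"
    using assms by (auto simp: truncated_heat_kernel_def)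
  have contK: "continuous_on (- {0}) K" by (rule continuous_on_smooth[OF sm])
  have "(\<lambda>z. if z \<in> - {0} then K z else K 0) \<in> borel_measurable borel"
    by (rule borel_measurable_continuous_on_if[OF _ contK]) auto
  moreover have "(\<lambda>z. if z \<in> - {0} then K z else K 0) = K" by auto
  ultimately have mK: "K \<in> borel_measurable borel" by simp
  have "compact (C - ball 0 r)" using C(1) by (rule compact_diff) simp
  moreover have "continuous_on (C - ball 0 r) K"
    using contK r(1) by (rule_tac continuous_on_subset) auto
  ultimately have "bounded (K ` (C - ball 0 r))"
    using compact_continuous_image compact_imp_bounded by blast
  then obtain M where M: "M > 0" "\<And>z. z \<in> C - ball 0 r \<Longrightarrow> \<bar>K z\<bar> \<le> M"
    by (auto simp: bounded_pos)
  \<comment> \<open>Points of \<open>ball 0 r\<close> have time coordinate below \<open>r\<close>,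
    so the restriction in time loses nothing on the ball; without it the total mass would be
    infinite.\<close>
  define G :: "'d point \<Rightarrow> real" where "G z = indicator {0<..<r} (fst z) * heat_kernel z" for z
  have Gm[measurable]: "G \<in> borel_measurable borel"
  proof -
    have [measurable]: "(fst :: 'd point \<Rightarrow> real) \<in> borel_measurable borel"
      by (intro borel_measurable_continuous_onI continuous_intros)
    note heat_kernel_measurable[measurable]
    show ?thesis unfolding G_def by measurable
  qed
  have G0: "G z \<ge> 0" for z
    by (auto simp: G_def heat_kernel_def indicator_def)
  have "(\<integral>\<^sup>+z. ennreal (G z) \<partial>lborel) = (\<integral>\<^sup>+t. \<integral>\<^sup>+x. ennreal (G (t, x)) \<partial>lborel \<partial>lborel)"
    unfolding lborel_prod[symmetric] by (rule lborel.nn_integral_fst[symmetric]) (simp add: lborel_prod)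
  also have "\<dots> = (\<integral>\<^sup>+t. indicator {0<..<r} t \<partial>lborel)"
  proof (rule nn_integral_cong)
    fix t :: real
    show "(\<integral>\<^sup>+x. ennreal (G (t, x)) \<partial>lborel) = indicator {0<..<r} t"
      using nn_integral_heat_kernel[of t, where 'd = 'd] by (auto simp: G_def indicator_def)
  qed
  also have "\<dots> < \<infinity>" using r(1) by simp
  finally have iG: "integrable lborel G"
    by (intro integrableI_nonneg) (auto simp: G0)
  show ?thesis
  proof (rule Bochner_Integration.integrable_bound)
    show "integrable lborel (\<lambda>z. G z + M * indicator C z)"
      using iG C(1) by (intro Bochner_Integration.integrable_add integrable_mult_right)
        (use emeasure_compact_finite[OF C(1)] borel_compact[OF C(1)] in auto)
    show "K \<in> borel_measurable lborel" using mK by simp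
    show "AE z in lborel. norm (K z) \<le> norm (G z + M * indicator C z)"
    proof (rule AE_I2)
      fix z
      consider "z \<in> ball 0 r" "fst z > 0" | "z \<in> ball 0 r" "fst z \<le> 0" | "z \<in> C - ball 0 r" | "z \<notin> C" "z \<notin> ball 0 r"
        by fastforce
      then show "norm (K z) \<le> norm (G z + M * indicator C z)"
      proof cases
        case 1
        then have "K z = G z"
          using norm_fst_le[of "fst z" "snd z"] r(2)[of z] by (auto simp: G_def)
        then show ?thesis using M(1) G0[of z] by simp
      next
        case 2
        then show ?thesis using r(2)[of z] by (auto simp: heat_kernel_def)
      next
        case 3
        then show ?thesis using M(2)[OF 3] G0[of z] by auto
      next
        case 4
        then show ?thesis by (simp add: C)
      qed
    qed
  qed
qed

section \<open>The convolution operator on smooth functions\<close>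

lemma smooth_dconv:
  assumes "truncated_heat_kernel K" "smooth_on UNIV g"
  shows "smooth_on UNIV (dconv a K g)"
proof -
  obtain C where "compact C" "\<And>z. z \<notin> C \<Longrightarrow> K z = 0"
    using assms(1) by (auto simp: truncated_heat_kernel_def)
  from smooth_conv[OF truncated_heat_kernel_integrable[OF assms(1)] this smooth_mderiv[OF assms(2)], of a]
  show ?thesis by (simp add: dconv_def[abs_def])
qed

lemma dconv_add:
  assumes "truncated_heat_kernel K" "smooth_on UNIV g" "smooth_on UNIV h"
  shows "dconv a K (\<lambda>y. g y + h y) y = dconv a K g y + dconv a K h y"
proof -
  obtain C where C: "compact C" "\<And>z. z \<notin> C \<Longrightarrow> K z = 0"
    using assms(1) by (auto simp: truncated_heat_kernel_def)
  note int = integrable_conv[OF truncated_heat_kernel_integrable[OF assms(1)] C continuous_on_smooth[OF smooth_mderiv]]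
  have "mderiv a (\<lambda>y. g y + h y) = (\<lambda>y. mderiv a g y + mderiv a h y)"
    unfolding mderiv_def using assms by (simp add: partials_add)
  then show ?thesis
    using assms int by (simp add: dconv_def distrib_left)
qed

lemma dconv_cmult:
  assumes "smooth_on UNIV g"
  shows "dconv a K (\<lambda>y. c * g y) y = c * dconv a K g y"
proof -
  have "mderiv a (\<lambda>y. c * g y) = (\<lambda>y. c * mderiv a g y)"
    unfolding mderiv_def using assms by (simp add: partials_cmult)
  then show ?thesis
    by (simp add: dconv_def mult.left_commute)
qed


section \<open>The structure of decorated trees\<close>

lemma XT_add: "XT (k + l) = XT k + XT l"
  by (simp add: XT_def plus_dtree_def)

lemma XT_zero: "XT 0 = 0"
  by (simp add: XT_def zero_dtree_def)

lemma Node_add_mset: "Node k (add_mset p E) = Node k E + Node 0 {#p#}"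
  by (simp add: plus_dtree_def)

lemma mabs_add: "mabs (k + l) = mabs k + mabs l"
  by (simp add: mabs_def sum.distrib)

lemma mabs_eq_0_iff: "mabs k = 0 \<longleftrightarrow> k = 0"
proof
  assume "mabs k = 0"
  then have "k $ j = 0" for j
    by (cases j) (simp_all add: mabs_def)
  then show "k = 0" by (simp add: vec_eq_iff)
qed (simp add: mabs_def)

text \<open>Measures the constraint \<open>l + m \<le> 1\<close> in \<open>TT\<close>, the only
  obstruction to a product of two trees of \<open>TT\<close> being in \<open>TT\<close>.\<close>

definition root_noises :: "'d::finite tree \<Rightarrow> nat" where
  "root_noises \<tau> = size (filter_mset (\<lambda>(e, \<sigma>). fst e \<noteq> EI) (branches \<tau>))"

lemma root_noises_simps:
  "root_noises (\<sigma> + \<tau>) = root_noises \<sigma> + root_noises \<tau>"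
  "root_noises (XT k) = 0"
  "root_noises (IT a \<tau>) = 0"
  by (simp_all add: root_noises_def plus_dtree_def XT_def IT_def)

lemma sum_trees:
  "(\<Sum>_<l. Node 0 {#p#}) = Node 0 (replicate_mset l p)"
  "(\<Sum>p\<in>#M. IT (fst p) (snd p)) = Node 0 (image_mset (\<lambda>p. ((EI, fst p), snd p)) M)"
proof -
  show "(\<Sum>_<l. Node 0 {#p#}) = Node 0 (replicate_mset l p)"
    by (induction l) (simp_all add: zero_dtree_def plus_dtree_def)
  show "(\<Sum>p\<in>#M. IT (fst p) (snd p)) = Node 0 (image_mset (\<lambda>p. ((EI, fst p), snd p)) M)"
    by (induction M) (simp_all add: zero_dtree_def plus_dtree_def IT_def)
qed

lemma TT_root_shape:
  "XT k + (\<Sum>_<l. Xi0T) + (\<Sum>_<m. Xi1T) + (\<Sum>p\<in>#M. IT (fst p) (snd p)) =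
    Node k (replicate_mset l ((EXi0, 0), 0) + replicate_mset m ((EXi1, 0), 0) +
      image_mset (\<lambda>p. ((EI, fst p), snd p)) M)"
  unfolding Xi0T_def Xi1T_def sum_trees by (simp add: XT_def plus_dtree_def)

text \<open>Replaces the normal form that generates \<open>TT\<close> by a condition checked branch
  by branch, which is stable under splitting the multiset of branches.\<close>

lemma Node_mem_TT_iff:
  "Node k E \<in> TT \<longleftrightarrow> root_noises (Node k E) \<le> 1 \<and>
    (\<forall>(e, \<sigma>)\<in>#E. if fst e = EI then \<sigma> \<in> TT else snd e = 0 \<and> \<sigma> = 0)" (is "?L \<longleftrightarrow> ?R")
proof
  assume ?L
  then show ?R
  proof cases
    case (1 l m M k')
    then have E: "E = replicate_mset l ((EXi0, 0), 0) + replicate_mset m ((EXi1, 0), 0) +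
        image_mset (\<lambda>p. ((EI, fst p), snd p)) M"
      unfolding TT_root_shape by simp
    have rep: "filter_mset P (replicate_mset n p) = (if P p then replicate_mset n p else {#})"
      for P and p :: "'a edec \<times> 'a tree" and n
      by (induction n) auto
    have I: "filter_mset (\<lambda>(e, \<sigma>). fst e \<noteq> EI) (image_mset (\<lambda>p. ((EI, fst p), snd p)) M) = {#}"
      by (induction M) auto
    show ?thesis
      using 1(2,3) by (auto simp: E root_noises_def rep I split: if_splits)
  qed
next
  assume R: ?R
  define A where "A = filter_mset (\<lambda>(e, \<sigma>). fst e = EI) E"
  define N where "N = filter_mset (\<lambda>(e, \<sigma>). fst e \<noteq> EI) E"
  define M where "M = image_mset (\<lambda>(e, \<sigma>). (snd e, \<sigma>)) A"
  have "E = N + A"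
    using multiset_partition[of E "\<lambda>(e, \<sigma>). fst e \<noteq> EI"] by (simp add: N_def A_def case_prod_unfold)
  have "image_mset (\<lambda>p. ((EI, fst p), snd p)) M = image_mset (\<lambda>x. x) A"
    unfolding M_def multiset.map_comp by (rule image_mset_cong) (auto simp: A_def)
  then have A: "A = image_mset (\<lambda>p. ((EI, fst p), snd p)) M" by simp
  have M: "\<forall>p\<in>set_mset M. snd p \<in> TT"
    using R by (auto simp: M_def A_def)
  have "size N \<le> 1" using R by (simp add: N_def root_noises_def)
  \<comment> \<open>No noise at the root means \<open>l = m = 0\<close>; a single noise edge is of
    type \<open>EXi0\<close> for \<open>l = 1\<close> and of type \<open>EXi1\<close> for
    \<open>m = 1\<close>.\<close>
  then consider "N = {#}" | p where "N = {#p#}"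
    by (metis One_nat_def le_Suc_eq le_zero_eq size_1_singleton_mset size_eq_0_iff_empty)
  then show ?L
  proof cases
    case 1
    with TT.intros[of 0 0 M k] M show ?thesis unfolding TT_root_shape \<open>E = N + A\<close> A by simp
  next
    case 2
    then have "p \<in># N" by simp
    then have "p \<in># E" "fst (fst p) \<noteq> EI" by (auto simp: N_def)
    then have "p = ((EXi0, 0), 0) \<or> p = ((EXi1, 0), 0)"
      using R by (cases p rule: prod.exhaust; cases "fst (fst p)") force+
    with TT.intros[of 1 0 M k] TT.intros[of 0 1 M k] M 2 show ?thesis
      unfolding TT_root_shape \<open>E = N + A\<close> A by auto
  qed
qed

lemma add_mem_TT_iff: "\<sigma> + \<tau> \<in> TT \<longleftrightarrow> \<sigma> \<in> TT \<and> \<tau> \<in> TT \<and> root_noises \<sigma> + root_noises \<tau> \<le> 1"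
proof -
  obtain k E l F where "\<sigma> = Node k E" "\<tau> = Node l F" by (cases \<sigma>; cases \<tau>)
  moreover have "Node k E + Node l F = Node (k + l) (E + F)" by (simp add: plus_dtree_def)
  ultimately show ?thesis
    using root_noises_simps(1)[of \<sigma> \<tau>] by (auto simp: Node_mem_TT_iff)
qed

lemma mem_TT_simps: "XT k \<in> TT" "Xi0T \<in> TT" "Xi1T \<in> TT" "IT a \<tau> \<in> TT \<longleftrightarrow> \<tau> \<in> TT"
  by (simp_all add: XT_def Xi0T_def Xi1T_def IT_def Node_mem_TT_iff root_noises_def)

text \<open>
  The last hypothesis for a planted tree reflects that a preparation map produces
  trees with fewer noises: the induction is on the number of noises and then on the size.
\<close>

lemma TT_induct_noise [consumes 1, case_names X Xi0 Xi1 add I]: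
  assumes "\<tau> \<in> TT"
    and X: "\<And>k. P (XT k)" and Xi0: "P Xi0T" and Xi1: "P Xi1T"
    and add: "\<And>\<sigma> \<tau>. \<sigma> + \<tau> \<in> TT \<Longrightarrow> P \<sigma> \<Longrightarrow> P \<tau> \<Longrightarrow> P (\<sigma> + \<tau>)"
    and I: "\<And>a \<tau>. \<tau> \<in> TT \<Longrightarrow> P \<tau> \<Longrightarrow> (\<And>\<rho>. \<rho> \<in> TT \<Longrightarrow> nnoise \<rho> < nnoise \<tau> \<Longrightarrow> P \<rho>) \<Longrightarrow> P (IT a \<tau>)"
  shows "P \<tau>"
  using assms(1)
proof (induction \<tau> rule: wf_induct_rule[OF wf_measures[of "[nnoise, size]"]])
  case (1 \<tau>)
  obtain k E where \<tau>: "\<tau> = Node k E" by (cases \<tau>)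
  have edge: "P (Node 0 {#(e, \<sigma>)#})" if mem: "(e, \<sigma>) \<in># E" for e \<sigma>
  proof (cases "fst e")
    case EI
    have "\<sigma> \<in> TT" using 1(2) mem EI by (auto simp: \<tau> Node_mem_TT_iff)
    moreover have nn: "nnoise \<sigma> \<le> nnoise \<tau>" using mem by (auto simp: \<tau> dest!: multi_member_split)
    moreover have "size \<sigma> < size \<tau>" using size_branch[OF mem] by (simp add: \<tau>)
    ultimately have "P (IT (snd e) \<sigma>)"
      by (intro I 1(1)) auto
    then show ?thesis using EI by (cases e) (simp add: IT_def)
  qed (use 1(2) mem Xi0 Xi1 in \<open>cases e; force simp: \<tau> Node_mem_TT_iff Xi0T_def Xi1T_def\<close>)+
  \<comment> \<open>The tree is assembled one branch at a time. Staying inside \<open>E\<close>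
    keeps each partial product in \<open>TT\<close>, as the product case demands.\<close>
  have "P (Node k F)" if "F \<subseteq># E" for F
    using that
  proof (induction F)
    case empty
    then show ?case using X[of k] by (simp add: XT_def)
  next
    case (add p F)
    obtain G where "E = add_mset p F + G" using add.prems by (auto simp: mset_subset_eq_exists_conv)
    then have "Node k (add_mset p F) + Node 0 G \<in> TT" using 1(2) by (simp add: \<tau> plus_dtree_def)
    then have "Node k F + Node 0 {#p#} \<in> TT" by (simp only: add_mem_TT_iff[of "Node k (add_mset p F)"] flip: Node_add_mset)
    moreover have "P (Node 0 {#p#})" using edge[of "fst p" "snd p"] add.prems by (simp add: insert_subset_eq_iff)
    moreover have "P (Node k F)" using add by (meson mset_subset_eq_add_mset_cancel subset_mset.order_trans mset_subset_eq_insertD subset_mset.less_imp_le)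
    ultimately show ?case unfolding Node_add_mset[of k p] by (intro assms(5))
  qed
  then show ?case by (simp add: \<tau>)
qed

lemma replaces_noise_TT: "replaces_noise \<tau> \<sigma> \<Longrightarrow> \<tau> \<in> TT \<Longrightarrow> \<sigma> \<in> TT"
proof (induction rule: replaces_noise.induct)
  case (1 k a \<sigma> E)
  then show ?case by (auto simp: Node_mem_TT_iff root_noises_def)
next
  case (2 \<sigma> \<sigma>' k e E)
  \<comment> \<open>A branch in which a noise is replaced has an edge, while nothing grows on a
    noise edge; so the edge leading to it is of type \<open>EI\<close>.\<close>
  have "\<sigma> \<noteq> 0" using 2(1) by (auto simp: zero_dtree_def elim: replaces_noise.cases)
  with 2 show ?case by (auto simp: Node_mem_TT_iff root_noises_def split: if_splits)
qed

lemma T1_of_subset_TT: "T1_of rl \<subseteq> TT"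
  by (auto simp: T1_of_def T0_of_def intro: replaces_noise_TT)


section \<open>Coactions evaluated at a character\<close>

lemma mpow_add: "mpow z (k + l) = mpow z k * mpow z l"
  by (simp add: mpow_def power_add prod.distrib)

lemma mpow_zero: "mpow z 0 = 1"
  by (simp add: mpow_def)

text \<open>The character with \<psi> left free on planted symbols, so that the coactions are
  evaluated once for both models. The minus sign of the recentring character is part of
  \<psi>.\<close>

definition tree_char :: "'d::finite point \<Rightarrow> ('d midx \<Rightarrow> 'd tree \<Rightarrow> real) \<Rightarrow> 'd ptree \<Rightarrow> real" where
  "tree_char x \<psi> = (\<lambda>(k, M). mpow (- x) k * (\<Prod>(a, \<tau>)\<in>#M. \<psi> a \<tau>))"

lemma tree_char_add: "tree_char x \<psi> (u + v) = tree_char x \<psi> u * tree_char x \<psi> v"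
  by (cases u; cases v) (simp add: tree_char_def mpow_add)

lemma tree_char_zero: "tree_char x \<psi> 0 = 1"
  by (simp add: tree_char_def zero_prod_def mpow_zero)

lemma contract_char_times:
  "contract (tree_char x \<psi>) (v * w) = contract (tree_char x \<psi>) v * contract (tree_char x \<psi>) w"
  for v w :: "'d::finite tree \<times> 'd ptree \<Rightarrow>\<^sub>0 real"
  by (rule contract_times) (rule tree_char_add)

lemma contract_char_one: "contract (tree_char x \<psi>) (1 :: 'd::finite tree \<times> 'd ptree \<Rightarrow>\<^sub>0 real) = 1"
  by (rule contract_one) (rule tree_char_zero)

lemma contract_char_prod:
  "contract (tree_char x \<psi>) (\<Prod>j\<in>A. f j ^ n j) = (\<Prod>j\<in>A. contract (tree_char x \<psi>) (f j) ^ n j)"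
  for f :: "_ \<Rightarrow> 'd::finite tree \<times> 'd ptree \<Rightarrow>\<^sub>0 real"
proof -
  have "contract (tree_char x \<psi>) (p ^ n) = contract (tree_char x \<psi>) p ^ n"
    for p :: "'d tree \<times> 'd ptree \<Rightarrow>\<^sub>0 real" and n
    by (induction n) (simp_all add: contract_char_one contract_char_times)
  then show ?thesis
    by (induction A rule: infinite_finite_induct) (simp_all add: contract_char_one contract_char_times)
qed

lemma lin_ext_char_one: "lin_ext (tree_char x \<psi>) 1 = 1"
  using lin_ext_bas[of "tree_char x \<psi>" 0] by (simp add: bas_zero tree_char_zero)

lemma lin_ext_char_times: "lin_ext (tree_char x \<psi>) (p * q) = lin_ext (tree_char x \<psi>) p * lin_ext (tree_char x \<psi>) q"
  by (rule lin_ext_times[of "(*)"])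
    (auto intro!: linearI simp: tree_char_add distrib_left distrib_right)

lemma contract_char_tensor_one: "contract (tree_char x \<psi>) (tensor p 1) = p"
  by (simp add: contract_tensor lin_ext_char_one)

section \<open>Recentred monomials\<close>

lemma prod_scaleR_poly:
  "(\<Prod>j\<in>A. c j *\<^sub>R p j) = (\<Prod>j\<in>A. c j) *\<^sub>R (\<Prod>j\<in>A. p j)"
  for p :: "_ \<Rightarrow> 'a::comm_monoid_add \<Rightarrow>\<^sub>0 real"
  by (induction A rule: infinite_finite_induct) (simp_all add: scaleR_times)

lemma bas_XT_prod: "(\<Prod>j\<in>UNIV. bas (XT (axis j 1)) ^ (k $ j)) = bas (XT k)" for k :: "'d::finite midx"
proof -
  have pow: "bas (XT (axis j 1)) ^ n = bas (XT (axis j n))" for j :: "'d option" and n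
  proof (induction n)
    case 0
    have "axis j 0 = (0 :: 'd midx)" by (simp add: vec_eq_iff axis_def)
    then show ?case by (simp only: XT_zero bas_zero power_0)
  next
    case (Suc n)
    have "axis j (Suc n) = axis j 1 + (axis j n :: 'd midx)" by (simp add: vec_eq_iff axis_def)
    then show ?case by (simp add: Suc XT_add bas_times del: One_nat_def)
  qed
  have "(\<Prod>j\<in>A. bas (XT (f j))) = bas (XT (\<Sum>j\<in>A. f j))" for A :: "'d option set" and f :: "_ \<Rightarrow> 'd midx"
    by (induction A rule: infinite_finite_induct) (simp_all add: XT_zero bas_zero XT_add bas_times)
  moreover have "(\<Sum>j\<in>UNIV. axis j (k $ j)) = k"
    by (simp add: vec_eq_iff axis_def if_distrib cong: if_cong)
  ultimately show ?thesis by (simp add: pow del: One_nat_def)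
qed

text \<open>The monomial \<open>(X - x)^k\<close>, expanded in the tree algebra.\<close>

definition shifted_monomial :: "'d::finite point \<Rightarrow> 'd midx \<Rightarrow> 'd tree \<Rightarrow>\<^sub>0 real" where
  "shifted_monomial x k = (\<Prod>j\<in>UNIV. (bas (XT (axis j 1)) + coord (- x) j *\<^sub>R 1) ^ (k $ j))"

lemma of_nat_times_poly: "of_nat n * p = real n *\<^sub>R p" for p :: "'a::comm_monoid_add \<Rightarrow>\<^sub>0 real"
  by (simp add: scaleR_eq_times single_of_nat)

lemma mfact_pos: "mfact k > 0"
  by (simp add: mfact_def prod_pos)

text \<open>The binomial theorem in each coordinate. Dividing by factorials makes the coefficients
  factor over the coordinates and matches the weights in the coaction.\<close>

lemma shifted_monomial_binomial:
  "(1 / mfact k) *\<^sub>R shifted_monomial x k =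
    (\<Sum>(l, m) | l + m = k. (mpow (- x) m / (mfact l * mfact m)) *\<^sub>R bas (XT l))"
proof -
  let ?c = "\<lambda>j. coord (- x) j"
  have one: "(1 / fact n) *\<^sub>R (p + c *\<^sub>R 1) ^ n = (\<Sum>i\<le>n. (c ^ (n - i) / (fact i * fact (n - i))) *\<^sub>R p ^ i)"
    for c :: real and p :: "'a tree \<Rightarrow>\<^sub>0 real" and n
  proof -
    have pc: "(c *\<^sub>R (1 :: 'a tree \<Rightarrow>\<^sub>0 real)) ^ i = c ^ i *\<^sub>R 1" for i
      by (induction i) (simp_all add: scaleR_times)
    have "(1 / fact n) *\<^sub>R (of_nat (n choose i) * p ^ i * (c *\<^sub>R 1) ^ (n - i)) =
        (1 / fact n * (real (n choose i) * c ^ (n - i))) *\<^sub>R p ^ i" for i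
      by (simp add: mult.assoc of_nat_times_poly pc scaleR_times)
    then have "(1 / fact n) *\<^sub>R (of_nat (n choose i) * p ^ i * (c *\<^sub>R 1) ^ (n - i)) =
        (c ^ (n - i) / (fact i * fact (n - i))) *\<^sub>R p ^ i" if "i \<le> n" for i
      using that by (simp add: binomial_fact)
    then show ?thesis
      unfolding binomial_ring scaleR_sum_right by (intro sum.cong) auto
  qed
  have "(1 / mfact k) *\<^sub>R shifted_monomial x k =
      (\<Prod>j\<in>UNIV. (1 / fact (k $ j)) *\<^sub>R (bas (XT (axis j 1)) + ?c j *\<^sub>R 1) ^ (k $ j))"
    by (simp add: shifted_monomial_def prod_scaleR_poly mfact_def prod_dividef)
  \<comment> \<open>Multiplying out picks an exponent \<open>g j\<close> in each coordinate; such a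
    choice is the pair with \<open>l = g\<close> and \<open>m = k - g\<close>.\<close>
  also have "\<dots> = (\<Sum>g\<in>PiE UNIV (\<lambda>j. {..k $ j}). \<Prod>j\<in>UNIV.
      (?c j ^ (k $ j - g j) / (fact (g j) * fact (k $ j - g j))) *\<^sub>R bas (XT (axis j 1)) ^ g j)"
    unfolding one by (rule prod_sum_PiE) auto
  also have "\<dots> = (\<Sum>(l, m) | l + m = k. (mpow (- x) m / (mfact l * mfact m)) *\<^sub>R bas (XT l))"
  proof (rule sum.reindex_bij_witness[where i = "\<lambda>(l, m). ($) l"
        and j = "\<lambda>g. (vec_lambda g, \<chi> j. k $ j - g j)"])
    fix g assume g: "g \<in> PiE UNIV (\<lambda>j. {..k $ j})"
    then have "g j \<le> k $ j" for j by auto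
    then show "(vec_lambda g, \<chi> j. k $ j - g j) \<in> {(l, m). l + m = k}"
      by (simp add: vec_eq_iff)
    show "(case (vec_lambda g, \<chi> j. k $ j - g j) of
        (l, m) \<Rightarrow> (mpow (- x) m / (mfact l * mfact m)) *\<^sub>R bas (XT l)) =
      (\<Prod>j\<in>UNIV. (?c j ^ (k $ j - g j) / (fact (g j) * fact (k $ j - g j))) *\<^sub>R bas (XT (axis j 1)) ^ g j)"
      using bas_XT_prod[of "vec_lambda g"]
      by (simp add: prod_scaleR_poly mpow_def mfact_def prod_dividef prod.distrib)
  qed (auto simp: vec_eq_iff, (metis add_diff_cancel_left' le_add1)+)
  finally show ?thesis .
qed

section \<open>Recentring of the generators and of planted trees\<close>

lemma contract_coact_XT:
  "contract (tree_char x \<psi>) (coact_tree \<alpha> i (XT k)) = shifted_monomial x k"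
proof -
  have "lin_ext (tree_char x \<psi>) (XP (axis j 1)) = coord (- x) j" for j
    by (simp add: XP_def tree_char_def mpow_def prod_axis_power del: One_nat_def)
  then have "contract (tree_char x \<psi>) (tensor (bas (XT (axis j 1))) 1 + tensor 1 (XP (axis j 1))) =
      bas (XT (axis j 1)) + coord (- x) j *\<^sub>R 1" for j
    unfolding linear_add[OF linear_contract] contract_char_tensor_one by (simp only: contract_tensor)
  then show ?thesis
    unfolding shifted_monomial_def XT_def[of k] by (simp add: contract_char_prod del: One_nat_def)
qed

lemma contract_coact_noise:
  "contract (tree_char x \<psi>) (coact_tree \<alpha> i Xi0T) = bas Xi0T"
  "contract (tree_char x \<psi>) (coact_tree \<alpha> i Xi1T) = bas Xi1T"
  by (simp_all add: coact_tree_noise contract_char_tensor_one)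

lemma linear_graft: "linear (graft a)"
  unfolding graft_def by (rule linear_lin_ext)

lemma graft_bas: "graft a (bas \<tau>) = bas (IT a \<tau>)"
  by (simp add: graft_def)

text \<open>The cut-off and the value of \<psi> depend on \<open>l\<close> and \<open>m\<close> only
  through \<open>k = l + m\<close>, so grouping the double sum by \<open>k\<close> leaves one
  binomial expansion for each \<open>k\<close>.\<close>

lemma contract_coact_IT:
  "contract (tree_char x \<psi>) (coact_tree \<alpha> i (IT a \<tau>)) =
    graft a (contract (tree_char x \<psi>) (coact_tree \<alpha> i \<tau>)) +
    (\<Sum>k | real (mabs k) < deg \<alpha> i (IT a \<tau>). (\<psi> (a + k) \<tau> / mfact k) *\<^sub>R shifted_monomial x k)"
proof -
  let ?F = "tree_char x \<psi>" and ?c = "deg \<alpha> i (IT a \<tau>)"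
  let ?t = "\<lambda>(l, m). (\<psi> (a + (l + m)) \<tau> * (mpow (- x) m / (mfact l * mfact m))) *\<^sub>R bas (XT l)"
  let ?S = "{(l, m :: 'a midx). real (mabs (l + m)) < ?c}" and ?T = "{k :: 'a midx. real (mabs k) < ?c}"
  have "contract ?F (tensor ((1 / mfact l) *\<^sub>R bas (XT l)) ((1 / mfact m) *\<^sub>R XP m * Iplus \<alpha> i (a + l + m) (bas \<tau>))) =
      ?t (l, m)" if "real (mabs (l + m)) < ?c" for l m
  proof -
    have "Iplus \<alpha> i (a + l + m) (bas \<tau>) = bas (0, {#(a + (l + m), \<tau>)#})"
      using that by (simp add: Iplus_def deg_IT mabs_add add.assoc)
    then show ?thesis
      by (simp add: contract_tensor XP_def scaleR_times lin_ext_scaleR tree_char_def mult_ac flip: bas_times)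
  qed
  then have "contract ?F (\<Sum>(l, m)\<in>?S.
      tensor ((1 / mfact l) *\<^sub>R bas (XT l)) ((1 / mfact m) *\<^sub>R XP m * Iplus \<alpha> i (a + l + m) (bas \<tau>))) = sum ?t ?S"
    unfolding linear_sum[OF linear_contract] by (intro sum.cong) auto
  also have "\<dots> = (\<Sum>k\<in>?T. sum ?t {p \<in> ?S. fst p + snd p = k})"
  proof (rule sum.group[symmetric])
    have "?S \<subseteq> ?T \<times> ?T" by (auto simp: mabs_add)
    then show "finite ?S" by (rule finite_subset) (intro finite_cartesian_product finite_mabs_less)
  qed (auto intro: finite_mabs_less)
  also have "\<dots> = (\<Sum>k\<in>?T. (\<psi> (a + k) \<tau> / mfact k) *\<^sub>R shifted_monomial x k)"
  proof (rule sum.cong[OF refl])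
    fix k assume "k \<in> ?T"
    then have "{p \<in> ?S. fst p + snd p = k} = {(l, m). l + m = k}" by auto
    then have "sum ?t {p \<in> ?S. fst p + snd p = k} =
        \<psi> (a + k) \<tau> *\<^sub>R (\<Sum>(l, m) | l + m = k. (mpow (- x) m / (mfact l * mfact m)) *\<^sub>R bas (XT l))"
      unfolding scaleR_sum_right by (intro sum.cong) auto
    then show "sum ?t {p \<in> ?S. fst p + snd p = k} = (\<psi> (a + k) \<tau> / mfact k) *\<^sub>R shifted_monomial x k"
      by (simp flip: shifted_monomial_binomial)
  qed
  finally show ?thesis
    unfolding coact_tree_IT linear_add[OF linear_contract] contract_tensor_map[OF linear_graft] by simp
qed

section \<open>The map \<open>hat_coact\<close> evaluated at a character\<close>

lemma contract_hat_XT: "contract (tree_char x \<psi>) (hat_coact_tree \<alpha> (XT k)) = bas (XT k)"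
  unfolding XT_def[of k] by (simp add: contract_char_prod contract_char_tensor_one bas_XT_prod[of k, unfolded XT_def[of k]] del: One_nat_def)

lemma contract_hat_noise:
  "contract (tree_char x \<psi>) (hat_coact_tree \<alpha> Xi0T) = bas Xi0T"
  "contract (tree_char x \<psi>) (hat_coact_tree \<alpha> Xi1T) = bas Xi1T"
  by (simp_all add: hat_coact_tree_noise contract_char_tensor_one)

lemma Mplus_tensor: "Mplus (tensor p q) = p * q"
  by (rule bilinear_eq_on_bas[of "\<lambda>p q. Mplus (tensor p q)" "(*)"])
    (auto intro: linear_comp[OF linear_tensor_left] linear_comp[OF linear_tensor_right] linear_lin_ext
      linear_times_left linear_times_right simp: Mplus_def tensor_bas)

text \<open>The lower cut-off \<open>c\<close> is a parameter because one value, the 1-degree of the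
  original planted tree, serves all trees \<sigma> in the image of the grafted one. The upper
  cut-off is where \<open>Iplus\<close> vanishes.\<close>

definition hat_graft :: "real \<Rightarrow> ('d::finite midx \<Rightarrow> 'd tree \<Rightarrow> real) \<Rightarrow> 'd midx \<Rightarrow> real \<Rightarrow> 'd tree \<Rightarrow> 'd tree \<Rightarrow>\<^sub>0 real" where
  "hat_graft \<alpha> \<psi> a c \<sigma> = bas (IT a \<sigma>) -
    (\<Sum>l | c \<le> real (mabs l) \<and> real (mabs l) < deg \<alpha> 0 (IT a \<sigma>). (\<psi> (a + l) \<sigma> / mfact l) *\<^sub>R bas (XT l))"

lemma contract_hat_IT:
  "contract (tree_char x \<psi>) (hat_coact_tree \<alpha> (IT a \<tau>)) =
    lin_ext (hat_graft \<alpha> \<psi> a (deg \<alpha> 1 (IT a \<tau>))) (contract (tree_char x \<psi>) (hat_coact_tree \<alpha> \<tau>))"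
proof -
  let ?F = "tree_char x \<psi>" and ?w = "hat_coact_tree \<alpha> \<tau>" and ?c = "deg \<alpha> 1 (IT a \<tau>)"
  let ?v = "contract ?F ?w"
  let ?g = "\<lambda>l. if ?c \<le> real (mabs l)
      then tensor ((1 / mfact l) *\<^sub>R bas (XT l)) (Mplus (tensor_map (Iplus \<alpha> 0 (a + l)) id ?w)) else 0"
  \<comment> \<open>The support of \<open>?g\<close> alone is not enough: for the sum over
    \<open>l\<close> to pass inside \<open>lin_ext\<close>, the finite set must also contain the
    indices contributed by each single \<sigma>, even if they cancel in total.\<close>
  define L where "L = {l. ?g l \<noteq> 0} \<union> (\<Union>\<sigma>\<in>Poly_Mapping.keys ?v. {l. real (mabs l) < deg \<alpha> 0 (IT a \<sigma>)})"
  have fin: "finite L"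
    unfolding L_def by (intro finite_UnI finite_UN_I finite_support_hat finite_mabs_less) auto
  have I: "lin_ext ?F (Iplus \<alpha> 0 (a + l) (bas \<sigma>)) = (if real (mabs l) < deg \<alpha> 0 (IT a \<sigma>) then \<psi> (a + l) \<sigma> else 0)" for l \<sigma>
    by (simp add: Iplus_def deg_IT mabs_add tree_char_def mpow_zero lin_ext_zero)
  have lin: "linear (\<lambda>z. lin_ext ?F (Mplus z))"
    unfolding Mplus_def by (intro linear_comp[OF linear_lin_ext] linear_lin_ext)
  have M: "lin_ext ?F (Mplus (tensor_map (Iplus \<alpha> 0 (a + l)) id ?w)) =
      lin_ext (\<lambda>\<sigma>. if real (mabs l) < deg \<alpha> 0 (IT a \<sigma>) then \<psi> (a + l) \<sigma> else 0) ?v" for l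
    unfolding tensor_map_def lin_ext_compose[OF lin] lin_ext_contract
    by (rule lin_ext_cong) (auto simp: Mplus_tensor lin_ext_char_times I)
  have "Sum_any ?g = sum ?g L"
    by (rule Sum_any.expand_superset[OF fin]) (auto simp: L_def)
  then have "contract ?F (Sum_any ?g) = (\<Sum>l\<in>L. contract ?F (?g l))"
    by (simp add: linear_sum[OF linear_contract])
  also have "\<dots> = (\<Sum>l\<in>L. lin_ext (\<lambda>\<sigma>. if ?c \<le> real (mabs l) \<and> real (mabs l) < deg \<alpha> 0 (IT a \<sigma>)
      then (\<psi> (a + l) \<sigma> / mfact l) *\<^sub>R bas (XT l) else 0) ?v)"
  proof (rule sum.cong[OF refl])
    fix l
    show "contract ?F (?g l) = lin_ext (\<lambda>\<sigma>. if ?c \<le> real (mabs l) \<and> real (mabs l) < deg \<alpha> 0 (IT a \<sigma>)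
      then (\<psi> (a + l) \<sigma> / mfact l) *\<^sub>R bas (XT l) else 0) ?v"
    proof (cases "?c \<le> real (mabs l)")
      case True
      then have "contract ?F (?g l) = lin_ext (\<lambda>\<sigma>. if real (mabs l) < deg \<alpha> 0 (IT a \<sigma>) then \<psi> (a + l) \<sigma> else 0) ?v
          *\<^sub>R ((1 / mfact l) *\<^sub>R bas (XT l))"
        by (simp add: contract_tensor M)
      also have "\<dots> = lin_ext (\<lambda>\<sigma>. (if real (mabs l) < deg \<alpha> 0 (IT a \<sigma>) then \<psi> (a + l) \<sigma> else 0)
          *\<^sub>R ((1 / mfact l) *\<^sub>R bas (XT l))) ?v"
        by (simp only: lin_ext_fun_scaleR_left)
      finally show ?thesis
        using True by (auto intro: lin_ext_cong elim!: trans)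
    qed (simp add: lin_ext_fun_zero linear_0[OF linear_contract])
  qed
  also have "\<dots> = lin_ext (\<lambda>\<sigma>. \<Sum>l | ?c \<le> real (mabs l) \<and> real (mabs l) < deg \<alpha> 0 (IT a \<sigma>).
      (\<psi> (a + l) \<sigma> / mfact l) *\<^sub>R bas (XT l)) ?v"
    unfolding lin_ext_fun_sum[symmetric]
  proof (rule lin_ext_cong[OF refl])
    fix \<sigma> assume "\<sigma> \<in> Poly_Mapping.keys ?v"
    then have "{l \<in> L. ?c \<le> real (mabs l) \<and> real (mabs l) < deg \<alpha> 0 (IT a \<sigma>)} =
        {l. ?c \<le> real (mabs l) \<and> real (mabs l) < deg \<alpha> 0 (IT a \<sigma>)}"
      by (auto simp: L_def)
    then show "(\<Sum>l\<in>L. if ?c \<le> real (mabs l) \<and> real (mabs l) < deg \<alpha> 0 (IT a \<sigma>)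
        then (\<psi> (a + l) \<sigma> / mfact l) *\<^sub>R bas (XT l) else 0) =
      (\<Sum>l | ?c \<le> real (mabs l) \<and> real (mabs l) < deg \<alpha> 0 (IT a \<sigma>). (\<psi> (a + l) \<sigma> / mfact l) *\<^sub>R bas (XT l))"
      by (simp only: sum.inter_filter[OF fin, symmetric])
  qed
  finally show ?thesis
    unfolding hat_coact_tree_IT linear_diff[OF linear_contract] contract_tensor_map[OF linear_graft]
    by (simp add: hat_graft_def[abs_def] lin_ext_fun_diff graft_def)
qed

text \<open>
  The degree bound is what makes the two cut-offs in the recursion for planted trees compatible:
  the terms kept by \<open>deg \<alpha> 1\<close> are among those already subtracted by \<open>deg \<alpha> 0\<close>.
\<close>

lemma contract_hat_mem_vspan:
  assumes "\<tau> \<in> TT"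
  shows "contract (tree_char x \<psi>) (hat_coact_tree \<alpha> \<tau>) \<in>
    vspan {\<sigma>\<in>TT. root_noises \<sigma> \<le> root_noises \<tau> \<and> deg \<alpha> 1 \<tau> \<le> deg \<alpha> 0 \<sigma>}"
  using assms
proof (induction rule: TT_induct_noise)
  case (X k)
  show ?case by (auto simp: contract_hat_XT mem_TT_simps deg_XT intro!: bas_mem_vspan)
next
  case Xi0
  show ?case by (auto simp: contract_hat_noise mem_TT_simps deg_Xi0T intro!: bas_mem_vspan)
next
  case Xi1
  \<comment> \<open>Among the generators the two degrees differ only here: the 0-degree is larger by
    \<open>(d + 2) / 2\<close>.\<close>
  show ?case by (auto simp: contract_hat_noise mem_TT_simps deg_Xi1T simp del: One_nat_def intro!: bas_mem_vspan)
next
  case (add \<sigma> \<tau>)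
  from add(2,3) show ?case
    unfolding hat_coact_tree_add contract_char_times
    by (rule times_mem_vspan) (use add(1) in \<open>auto simp: add_mem_TT_iff deg_add root_noises_simps\<close>)
next
  case (I a \<tau>)
  show ?case
    unfolding contract_hat_IT
  proof (rule lin_ext_mem_subspace[OF subspace_vspan])
    fix \<sigma> assume "\<sigma> \<in> Poly_Mapping.keys (contract (tree_char x \<psi>) (hat_coact_tree \<alpha> \<tau>))"
    then have "\<sigma> \<in> TT" "deg \<alpha> 1 \<tau> \<le> deg \<alpha> 0 \<sigma>" using I(2) by (auto simp: mem_vspan_iff)
    \<comment> \<open>The planted term inherits the bound from \<sigma>; the monomials satisfy it
      because their order is at least the lower cut-off.\<close>
    then show "hat_graft \<alpha> \<psi> a (deg \<alpha> 1 (IT a \<tau>)) \<sigma> \<in>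
        vspan {\<sigma>\<in>TT. root_noises \<sigma> \<le> root_noises (IT a \<tau>) \<and> deg \<alpha> 1 (IT a \<tau>) \<le> deg \<alpha> 0 \<sigma>}"
      unfolding hat_graft_def
      by (intro subspace_diff subspace_sum subspace_scale subspace_vspan bas_mem_vspan)
        (auto simp: mem_TT_simps root_noises_simps deg_IT deg_XT)
  qed
qed

section \<open>Triangularity and injectivity of recentring\<close>

lemma shifted_monomial_lower:
  "shifted_monomial x k - bas (XT k) \<in> vspan {\<sigma>. deg \<alpha> i \<sigma> < deg \<alpha> i (XT k)}"
proof -
  let ?t = "\<lambda>(l, m). (mpow (- x) m / (mfact l * mfact m)) *\<^sub>R bas (XT l)"
  let ?S = "{(l, m). l + m = k}"
  have "?S \<subseteq> {l. real (mabs l) < real (mabs k) + 1} \<times> {l. real (mabs l) < real (mabs k) + 1}"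
    by (auto simp: mabs_add)
  then have "finite ?S" by (rule finite_subset) (intro finite_cartesian_product finite_mabs_less)
  \<comment> \<open>The pair \<open>(k, 0)\<close> gives the leading term; in every other pair
    \<open>m\<close> is nonzero and lowers the degree of \<open>X^l\<close>.\<close>
  then have "sum ?t ?S = ?t (k, 0) + sum ?t (?S - {(k, 0)})"
    by (rule sum.remove) simp
  moreover have "?t (k, 0) = (1 / mfact k) *\<^sub>R bas (XT k)"
    by (simp add: mpow_zero mfact_def)
  ultimately have "shifted_monomial x k = mfact k *\<^sub>R ((1 / mfact k) *\<^sub>R bas (XT k) + sum ?t (?S - {(k, 0)}))"
    using shifted_monomial_binomial[of k x] mfact_pos[of k]
    by (metis (no_types, lifting) less_numeral_extra(3) nonzero_divide_eq_eq scaleR_one scaleR_scaleR times_divide_eq_left mult.commute)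
  then have "shifted_monomial x k - bas (XT k) = mfact k *\<^sub>R sum ?t (?S - {(k, 0)})"
    using mfact_pos[of k] by (simp add: scaleR_add_right)
  also have "\<dots> \<in> vspan {\<sigma>. deg \<alpha> i \<sigma> < deg \<alpha> i (XT k)}"
  proof (intro subspace_scale subspace_sum subspace_vspan)
    fix p assume p: "p \<in> ?S - {(k, 0)}"
    obtain l m where lm: "p = (l, m)" by (cases p)
    with p have "mabs m > 0" using mabs_eq_0_iff[of m] by auto
    then show "?t p \<in> vspan {\<sigma>. deg \<alpha> i \<sigma> < deg \<alpha> i (XT k)}"
      using p by (auto simp: lm deg_XT mabs_add intro!: subspace_scale[OF subspace_vspan] bas_mem_vspan)
  qed
  finally show ?thesis .
qed

text \<open>Recentring is unitriangular for the degree: planting shifts all degrees equally, the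
  polynomial part is cut off strictly below the degree of the planted tree, and in a product every
  correction has a factor of lower degree.\<close>

lemma contract_coact_lower:
  assumes "\<tau> \<in> TT"
  shows "contract (tree_char x \<psi>) (coact_tree \<alpha> i \<tau>) - bas \<tau> \<in> vspan {\<sigma>. deg \<alpha> i \<sigma> < deg \<alpha> i \<tau>}"
  using assms
proof (induction rule: TT_induct_noise)
  case (X k)
  show ?case by (simp only: contract_coact_XT shifted_monomial_lower)
next
  case Xi0
  show ?case by (simp add: contract_coact_noise subspace_0 subspace_vspan)
next
  case Xi1
  show ?case by (simp add: contract_coact_noise subspace_0 subspace_vspan)
next
  case (add \<sigma> \<tau>)
  let ?V = "vspan {\<rho>. deg \<alpha> i \<rho> < deg \<alpha> i (\<sigma> + \<tau>)}"
  define A where "A = contract (tree_char x \<psi>) (coact_tree \<alpha> i \<sigma>) - bas \<sigma>"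
  define B where "B = contract (tree_char x \<psi>) (coact_tree \<alpha> i \<tau>) - bas \<tau>"
  have "contract (tree_char x \<psi>) (coact_tree \<alpha> i (\<sigma> + \<tau>)) - bas (\<sigma> + \<tau>) = A * B + A * bas \<tau> + bas \<sigma> * B"
    by (simp add: coact_tree_add contract_char_times bas_times A_def B_def algebra_simps)
  moreover have "A * B \<in> ?V"
    using add(2,3) unfolding A_def B_def by (rule times_mem_vspan) (auto simp: deg_add)
  moreover have "A * bas \<tau> \<in> ?V"
    using add(2) bas_mem_vspan[of \<tau> "{\<tau>}"] unfolding A_def by (rule times_mem_vspan) (auto simp: deg_add)
  moreover have "bas \<sigma> * B \<in> ?V"
    using bas_mem_vspan[of \<sigma> "{\<sigma>}"] add(3) unfolding B_def by (rule times_mem_vspan) (auto simp: deg_add)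
  ultimately show ?case by (simp add: subspace_add subspace_vspan)
next
  case (I a \<tau>)
  let ?V = "vspan {\<sigma>. deg \<alpha> i \<sigma> < deg \<alpha> i (IT a \<tau>)}"
  have "graft a (contract (tree_char x \<psi>) (coact_tree \<alpha> i \<tau>) - bas \<tau>) \<in> ?V"
    by (rule linear_image_vspan[OF linear_graft subspace_vspan _ I(2)])
      (auto simp: graft_bas deg_IT intro!: bas_mem_vspan)
  moreover have "(\<Sum>k | real (mabs k) < deg \<alpha> i (IT a \<tau>). (\<psi> (a + k) \<tau> / mfact k) *\<^sub>R shifted_monomial x k) \<in> ?V"
  proof (intro subspace_sum subspace_scale subspace_vspan)
    fix k :: "'a midx" assume k: "k \<in> {k. real (mabs k) < deg \<alpha> i (IT a \<tau>)}"
    have "shifted_monomial x k - bas (XT k) \<in> ?V"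
      using k by (intro mem_vspan_mono[OF shifted_monomial_lower[of x k \<alpha> i]]) (auto simp: deg_XT)
    moreover have "bas (XT k) \<in> ?V" using k by (auto simp: deg_XT intro!: bas_mem_vspan)
    ultimately have "(shifted_monomial x k - bas (XT k)) + bas (XT k) \<in> ?V"
      by (rule subspace_add[OF subspace_vspan])
    then show "shifted_monomial x k \<in> ?V" by simp
  qed
  ultimately show ?case
    unfolding contract_coact_IT linear_diff[OF linear_graft] graft_bas
    using subspace_add[OF subspace_vspan] by (fastforce simp: algebra_simps)
qed

text \<open>A kernel element is, up to sign, its own lower-order correction, so its finite support
  cannot contain a tree of maximal degree.\<close>

lemma recentring_injective:
  assumes v: "v \<in> vspan TT" and 0: "contract (tree_char x \<psi>) (coact \<alpha> i v) = 0"
  shows "v = 0"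
proof (rule ccontr)
  let ?G = "\<lambda>\<sigma>. contract (tree_char x \<psi>) (coact_tree \<alpha> i \<sigma>)"
  assume "v \<noteq> 0"
  define m where "m = Max (deg \<alpha> i ` Poly_Mapping.keys v)"
  have ne: "deg \<alpha> i ` Poly_Mapping.keys v \<noteq> {}" using \<open>v \<noteq> 0\<close> by simp
  from Max_in[OF _ ne] obtain \<tau> where \<tau>: "\<tau> \<in> Poly_Mapping.keys v" "deg \<alpha> i \<tau> = m"
    by (auto simp: m_def)
  have "lin_ext (\<lambda>\<sigma>. ?G \<sigma> - bas \<sigma>) v \<in> vspan {\<sigma>. deg \<alpha> i \<sigma> < m}"
  proof (rule lin_ext_mem_subspace[OF subspace_vspan])
    fix \<sigma> assume \<sigma>: "\<sigma> \<in> Poly_Mapping.keys v"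
    then have "deg \<alpha> i \<sigma> \<le> m" by (simp add: m_def)
    moreover have "\<sigma> \<in> TT" using \<sigma> v by (auto simp: mem_vspan_iff)
    ultimately show "?G \<sigma> - bas \<sigma> \<in> vspan {\<sigma>. deg \<alpha> i \<sigma> < m}"
      by (intro mem_vspan_mono[OF contract_coact_lower]) auto
  qed
  moreover have "lin_ext (\<lambda>\<sigma>. ?G \<sigma> - bas \<sigma>) v = - v"
    using 0 by (simp add: lin_ext_fun_diff lin_ext_self coact_def lin_ext_compose[OF linear_contract])
  ultimately have "Poly_Mapping.keys v \<subseteq> {\<sigma>. deg \<alpha> i \<sigma> < m}"
    by (simp add: mem_vspan_iff)
  with \<tau> show False by auto
qed


section \<open>Prepared models\<close>

text \<open>The third part keeps just the noise count: the trees in \<open>R (bas \<tau>)\<close>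
  are \<tau> and trees that an induction on noises has already reached.\<close>

lemma preparation_mapD:
  assumes "preparation_map \<alpha> rl R"
  shows "linear R"
    and "v \<in> vspan TT \<Longrightarrow> R v \<in> vspan TT"
    and "\<tau> \<in> TT \<Longrightarrow> R (bas \<tau>) \<in> vspan (insert \<tau> {\<sigma>\<in>TT. nnoise \<sigma> < nnoise \<tau>})"
    and "i = 0 \<or> i = 1 \<Longrightarrow> v \<in> vspan TT \<Longrightarrow> contract F (coact \<alpha> i (R v)) = R (contract F (coact \<alpha> i v))"
proof -
  show lin: "linear R" using assms by (simp add: preparation_map_def)
  show "R v \<in> vspan TT" if "v \<in> vspan TT" using that assms by (auto simp: preparation_map_def)
  show "R (bas \<tau>) \<in> vspan (insert \<tau> {\<sigma>\<in>TT. nnoise \<sigma> < nnoise \<tau>})" if "\<tau> \<in> TT"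
  proof -
    have "R (bas \<tau>) - bas \<tau> \<in> vspan {\<sigma>\<in>TT. deg \<alpha> 1 \<sigma> \<ge> deg \<alpha> 1 \<tau> \<and> nnoise \<sigma> < nnoise \<tau>}"
      using assms that by (simp add: preparation_map_def)
    then have "R (bas \<tau>) - bas \<tau> \<in> vspan (insert \<tau> {\<sigma>\<in>TT. nnoise \<sigma> < nnoise \<tau>})"
      by (rule mem_vspan_mono) auto
    from subspace_add[OF subspace_vspan this bas_mem_vspan[of \<tau>]] show ?thesis by simp
  qed
  show "contract F (coact \<alpha> i (R v)) = R (contract F (coact \<alpha> i v))"
    if "i = 0 \<or> i = 1" "v \<in> vspan TT"
  proof -
    have "tensor_map R id (coact \<alpha> i v) = coact \<alpha> i (R v)"
      using assms that by (auto simp: preparation_map_def)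
    then show ?thesis using contract_tensor_map[OF lin, of F "coact \<alpha> i v"] by simp
  qed
qed

lemma prepared_modelD:
  assumes "prepared_model \<alpha> R K \<xi> \<delta>\<xi> i P"
  shows "linear (\<lambda>v. P x v y)"
    and "\<sigma> + \<tau> \<in> TT \<Longrightarrow> P x (bas (\<sigma> + \<tau>)) y = P x (bas \<sigma>) y * P x (bas \<tau>) y"
    and "P x (bas (XT k)) y = mpow (y - x) k"
    and "P x (bas Xi0T) = \<xi>"
    and "P x (bas Xi1T) = \<delta>\<xi>"
    and "\<tau> \<in> TT \<Longrightarrow> P x (bas (IT a \<tau>)) y = dconv a K (P x (R (bas \<tau>))) y -
        (\<Sum>k | real (mabs k) < deg \<alpha> i (IT a \<tau>).
          mpow (y - x) k / mfact k * dconv (a + k) K (P x (R (bas \<tau>))) x)"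
  using assms unfolding prepared_model_def by blast+

locale smooth_prepared_model =
  fixes \<alpha> :: real and rl :: "'d::finite rule" and R :: "('d tree \<Rightarrow>\<^sub>0 real) \<Rightarrow> 'd tree \<Rightarrow>\<^sub>0 real"
    and K \<xi> \<delta>\<xi> :: "'d point \<Rightarrow> real" and i :: nat
    and P :: "'d point \<Rightarrow> ('d tree \<Rightarrow>\<^sub>0 real) \<Rightarrow> 'd point \<Rightarrow> real"
  assumes prep: "preparation_map \<alpha> rl R" and kernel: "truncated_heat_kernel K"
    and noise: "smooth_on UNIV \<xi>" "smooth_on UNIV \<delta>\<xi>"
    and model: "prepared_model \<alpha> R K \<xi> \<delta>\<xi> i P"
begin

lemma lin: "linear (\<lambda>v. P x v y)"
  by (rule prepared_modelD[OF model])

lemma subspace_smooth: "subspace {v. smooth_on UNIV (P x v)}"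
proof (rule subspaceI)
  have 0: "P x 0 = (\<lambda>y. 0)" and add: "P x (v + w) = (\<lambda>y. P x v y + P x w y)"
    and scale: "P x (c *\<^sub>R v) = (\<lambda>y. c * P x v y)" for v w c
    by (simp_all add: fun_eq_iff linear_0[OF lin] linear_add[OF lin] linear_cmul[OF lin])
  show "0 \<in> {v. smooth_on UNIV (P x v)}" by (simp add: 0 smooth_const)
  show "v + w \<in> {v. smooth_on UNIV (P x v)}"
    if "v \<in> {v. smooth_on UNIV (P x v)}" "w \<in> {v. smooth_on UNIV (P x v)}" for v w
    using that by (simp add: add smooth_add)
  show "c *\<^sub>R v \<in> {v. smooth_on UNIV (P x v)}" if "v \<in> {v. smooth_on UNIV (P x v)}" for c v
    using that by (simp add: scale smooth_scaleR)
qed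

lemma smooth_bas: "\<tau> \<in> TT \<Longrightarrow> smooth_on UNIV (P x (bas \<tau>))"
proof (induction rule: TT_induct_noise)
  case (X k)
  show ?case using smooth_mpow[of x k] by (simp add: prepared_modelD(3)[OF model, abs_def])
next
  case (add \<sigma> \<tau>)
  have "P x (bas (\<sigma> + \<tau>)) = (\<lambda>y. P x (bas \<sigma>) y * P x (bas \<tau>) y)"
    by (rule ext) (rule prepared_modelD(2)[OF model add(1)])
  with add show ?case by (simp add: smooth_mult)
next
  case (I a \<tau>)
  \<comment> \<open>For the identity map, \<open>linear_image_vspan\<close> says that a subspace
    containing the basis vectors contains their span.\<close>
  have "smooth_on UNIV (P x (R (bas \<tau>)))"
    using linear_image_vspan[OF linear_id[unfolded id_def] subspace_smooth[of x] _ preparation_mapD(3)[OF prep I(1)]] I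
    by auto
  moreover have "P x (bas (IT a \<tau>)) = (\<lambda>y. dconv a K (P x (R (bas \<tau>))) y -
        (\<Sum>k | real (mabs k) < deg \<alpha> i (IT a \<tau>).
          (dconv (a + k) K (P x (R (bas \<tau>))) x / mfact k) * mpow (y - x) k))"
    by (rule ext) (simp add: prepared_modelD(6)[OF model I(1)] mult_ac)
  ultimately show ?case
    by (simp only:) (intro smooth_diff smooth_dconv smooth_sum smooth_scaleR smooth_mpow kernel)
qed (simp_all add: prepared_modelD[OF model] noise)

lemma smooth: "v \<in> vspan TT \<Longrightarrow> smooth_on UNIV (P x v)"
  using linear_image_vspan[OF linear_id[unfolded id_def] subspace_smooth[of x], of TT v] smooth_bas by auto

text \<open>\<open>dconv\<close> is linear along trees because every function that occurs is smooth.
  This lets a convolution be resolved into the convolutions that define the individual planted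
  trees.\<close>

lemma dconv_eq_lin_ext:
  assumes "v \<in> vspan TT"
  shows "dconv a K (P x (R v)) y = lin_ext (\<lambda>\<sigma>. dconv a K (P x (R (bas \<sigma>))) y) v"
proof -
  \<comment> \<open>Membership is carried along, since the smoothness of the remaining sum depends
    on it.\<close>
  have "v \<in> vspan TT \<and> ?thesis"
    using assms unfolding vspan_def
  proof (induction rule: span_induct_alt)
    case base
    \<comment> \<open>The zero function is written as a multiple so that \<open>dconv_cmult\<close>
      applies.\<close>
    have "P x (R 0) = (\<lambda>y. 0 * 0)"
      by (simp add: fun_eq_iff linear_0[OF lin] linear_0[OF preparation_mapD(1)[OF prep]])
    then show ?case using dconv_cmult[OF smooth_const[of 0], of a K 0 y] by (simp add: lin_ext_zero span_zero)
  next
    case (step c b w)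
    obtain \<sigma> where b: "b = bas \<sigma>" "\<sigma> \<in> TT" using step(1) by blast
    note linR = preparation_mapD(1)[OF prep]
    have s: "smooth_on UNIV (P x (R b))" "smooth_on UNIV (P x (R w))"
      using b step by (auto intro!: smooth preparation_mapD(2)[OF prep] bas_mem_vspan simp: vspan_def)
    have "P x (R (c *\<^sub>R b + w)) = (\<lambda>y. c * P x (R b) y + P x (R w) y)"
      by (simp add: fun_eq_iff linear_add[OF linR] linear_cmul[OF linR] linear_add[OF lin] linear_cmul[OF lin])
    then have "dconv a K (P x (R (c *\<^sub>R b + w))) y = c * dconv a K (P x (R b)) y + dconv a K (P x (R w)) y"
      using s by (simp add: dconv_add[OF kernel] smooth_scaleR dconv_cmult)
    moreover have "c *\<^sub>R b + w \<in> span (bas ` TT)"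
      using step span_base[OF step(1)] by (blast intro: span_add span_scale)
    ultimately show ?case
      using step by (simp add: b lin_ext_plus lin_ext_scaleR)
  qed
  then show ?thesis by blast
qed

text \<open>The model is multiplicative only along products that stay in \<open>TT\<close>; the sets
  \<open>A\<close> and \<open>B\<close> carry this restriction through the bilinear
  extension.\<close>

lemma mult:
  assumes "v \<in> vspan A" "w \<in> vspan B" and TT: "\<And>\<sigma> \<tau>. \<sigma> \<in> A \<Longrightarrow> \<tau> \<in> B \<Longrightarrow> \<sigma> + \<tau> \<in> TT"
  shows "P x (v * w) y = P x v y * P x w y"
proof -
  have left: "linear (\<lambda>v. P x v y * c)" and right: "linear (\<lambda>w. c * P x w y)" for c
    by (auto intro!: linearI simp: linear_add[OF lin] linear_cmul[OF lin] distrib_left distrib_right)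
  show ?thesis
  proof (rule linear_eq_on_vspan[OF linear_comp[OF linear_times_right lin] left _ assms(1)])
    fix \<sigma> assume \<sigma>: "\<sigma> \<in> A"
    show "P x (bas \<sigma> * w) y = P x (bas \<sigma>) y * P x w y"
      by (rule linear_eq_on_vspan[OF linear_comp[OF linear_times_left lin] right _ assms(2)])
        (simp add: prepared_modelD(2)[OF model] TT \<sigma> flip: bas_times)
  qed
qed

end


section \<open>Comparison of the two models\<close>

lemma sum_mabs_split:
  fixes f :: "'d::finite midx \<Rightarrow> 'a::comm_monoid_add"
  assumes "c \<le> D"
  shows "(\<Sum>k | real (mabs k) < D. f k) =
    (\<Sum>k | real (mabs k) < c. f k) + (\<Sum>k | c \<le> real (mabs k) \<and> real (mabs k) < D. f k)"
proof -
  have "{k :: 'd midx. real (mabs k) < D} = {k. real (mabs k) < c} \<union> {k. c \<le> real (mabs k) \<and> real (mabs k) < D}"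
    using assms by auto
  moreover have "finite {k :: 'd midx. c \<le> real (mabs k) \<and> real (mabs k) < D}"
    by (rule finite_subset[OF _ finite_mabs_less[of D]]) auto
  ultimately show ?thesis
    by (simp only:) (rule sum.union_disjoint; auto intro: finite_mabs_less)
qed

locale model_pair =
  m0: smooth_prepared_model \<alpha> rl R K \<xi> \<delta>\<xi> 0 P0 + m1: smooth_prepared_model \<alpha> rl R K \<xi> \<delta>\<xi> 1 P1
  for \<alpha> :: real and rl :: "'d::finite rule" and R and K \<xi> \<delta>\<xi> and P0 P1
    :: "'d point \<Rightarrow> ('d tree \<Rightarrow>\<^sub>0 real) \<Rightarrow> 'd point \<Rightarrow> real" +
  fixes x :: "'d point"
begin

definition \<psi>0 :: "'d midx \<Rightarrow> 'd tree \<Rightarrow> real" where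
  "\<psi>0 a \<tau> = - dconv a K (P0 x (R (bas \<tau>))) x"

definition \<psi>1 :: "'d midx \<Rightarrow> 'd tree \<Rightarrow> real" where
  "\<psi>1 a \<tau> = - dconv a K (P1 x (R (bas \<tau>))) x"

text \<open>The map \<open>S\<close> of the overview.\<close>

definition transfer :: "('d tree \<Rightarrow>\<^sub>0 real) \<Rightarrow> 'd tree \<Rightarrow>\<^sub>0 real" where
  "transfer v = contract (tree_char x \<psi>0) (hat_coact \<alpha> v)"

definition \<Gamma>0 :: "('d tree \<Rightarrow>\<^sub>0 real) \<Rightarrow> 'd tree \<Rightarrow>\<^sub>0 real" where
  "\<Gamma>0 v = contract (tree_char x \<psi>0) (coact \<alpha> 0 v)"

definition \<Gamma>1 :: "('d tree \<Rightarrow>\<^sub>0 real) \<Rightarrow> 'd tree \<Rightarrow>\<^sub>0 real" where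
  "\<Gamma>1 v = contract (tree_char x \<psi>1) (coact \<alpha> 1 v)"

lemma linear_R: "linear R"
  by (rule preparation_mapD[OF m0.prep])

lemma linear_transfer: "linear transfer"
  unfolding transfer_def hat_coact_def by (rule linear_comp[OF linear_lin_ext linear_contract])

lemma linear_\<Gamma>0: "linear \<Gamma>0"
  unfolding \<Gamma>0_def coact_def by (rule linear_comp[OF linear_lin_ext linear_contract])

lemma linear_\<Gamma>1: "linear \<Gamma>1"
  unfolding \<Gamma>1_def coact_def by (rule linear_comp[OF linear_lin_ext linear_contract])

lemma transfer_bas: "transfer (bas \<tau>) = contract (tree_char x \<psi>0) (hat_coact_tree \<alpha> \<tau>)"
  by (simp add: transfer_def hat_coact_def)

lemma \<Gamma>0_bas: "\<Gamma>0 (bas \<tau>) = contract (tree_char x \<psi>0) (coact_tree \<alpha> 0 \<tau>)"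
  by (simp add: \<Gamma>0_def coact_def)

lemma \<Gamma>1_bas: "\<Gamma>1 (bas \<tau>) = contract (tree_char x \<psi>1) (coact_tree \<alpha> 1 \<tau>)"
  by (simp add: \<Gamma>1_def coact_def)

lemma \<Gamma>0_times: "\<Gamma>0 (v * w) = \<Gamma>0 v * \<Gamma>0 w"
  unfolding \<Gamma>0_def coact_def
  by (subst lin_ext_times[of "(*)", OF linear_times_right linear_times_left coact_tree_add])
    (rule contract_char_times)

lemma transfer_mem_vspan: "v \<in> vspan TT \<Longrightarrow> transfer v \<in> vspan TT"
proof (rule linear_image_vspan[OF linear_transfer subspace_vspan])
  show "transfer (bas \<tau>) \<in> vspan TT" if "\<tau> \<in> TT" for \<tau>
    unfolding transfer_bas by (rule mem_vspan_mono[OF contract_hat_mem_vspan[OF that]]) auto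
qed

text \<open>
  Here the sum subtracted in \<open>hat_graft\<close> turns the Taylor cut-off \<open>deg \<alpha> 0\<close> of the first model
  into the cut-off \<open>c\<close>.
\<close>

lemma model_hat_graft:
  assumes "\<sigma> \<in> TT" "c \<le> deg \<alpha> 0 (IT a \<sigma>)"
  shows "P0 x (hat_graft \<alpha> \<psi>0 a c \<sigma>) y = dconv a K (P0 x (R (bas \<sigma>))) y -
    (\<Sum>k | real (mabs k) < c. mpow (y - x) k / mfact k * dconv (a + k) K (P0 x (R (bas \<sigma>))) x)"
proof -
  let ?t = "\<lambda>k. mpow (y - x) k / mfact k * dconv (a + k) K (P0 x (R (bas \<sigma>))) x"
  have "P0 x (hat_graft \<alpha> \<psi>0 a c \<sigma>) y = P0 x (bas (IT a \<sigma>)) y +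
      (\<Sum>k | c \<le> real (mabs k) \<and> real (mabs k) < deg \<alpha> 0 (IT a \<sigma>). ?t k)"
    unfolding hat_graft_def
    by (simp add: linear_diff[OF m0.lin] linear_sum[OF m0.lin] linear_cmul[OF m0.lin]
        linear_neg[OF m0.lin] prepared_modelD(3)[OF m0.model] \<psi>0_def mult_ac flip: sum_negf)
  then show ?thesis
    by (simp add: prepared_modelD(6)[OF m0.model assms(1)] sum_mabs_split[OF assms(2)])
qed

text \<open>\<open>\<Gamma>0\<close> sends \<open>X^l\<close> to the shifted monomial, so the
  monomials subtracted in \<open>hat_graft\<close> cancel exactly the terms between \<open>c\<close>
  and the 0-degree.\<close>

lemma \<Gamma>0_hat_graft:
  assumes "c \<le> deg \<alpha> 0 (IT a \<sigma>)"
  shows "\<Gamma>0 (hat_graft \<alpha> \<psi>0 a c \<sigma>) = graft a (\<Gamma>0 (bas \<sigma>)) +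
    (\<Sum>k | real (mabs k) < c. (\<psi>0 (a + k) \<sigma> / mfact k) *\<^sub>R shifted_monomial x k)"
  unfolding hat_graft_def
  by (simp add: linear_diff[OF linear_\<Gamma>0] linear_sum[OF linear_\<Gamma>0] linear_cmul[OF linear_\<Gamma>0]
      \<Gamma>0_bas contract_coact_XT contract_coact_IT sum_mabs_split[OF assms])

text \<open>The recentring identity is a premise at \<tau> and at \<open>R (bas \<tau>)\<close>
  only, so that commutation is available inside the induction that proves this identity.\<close>

lemma commute_transfer:
  assumes "\<tau> \<in> TT" and \<Gamma>: "\<Gamma>0 (transfer (bas \<tau>)) = \<Gamma>1 (bas \<tau>)"
    and \<Gamma>': "\<Gamma>0 (transfer (R (bas \<tau>))) = \<Gamma>1 (R (bas \<tau>))"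
  shows "transfer (R (bas \<tau>)) = R (transfer (bas \<tau>))"
proof -
  have mem: "bas \<tau> \<in> vspan TT" using assms(1) by (rule bas_mem_vspan)
  have "\<Gamma>0 (transfer (R (bas \<tau>))) = R (\<Gamma>1 (bas \<tau>))"
    unfolding \<Gamma>' \<Gamma>1_def using preparation_mapD(4)[OF m0.prep _ mem] by simp
  also have "\<dots> = \<Gamma>0 (R (transfer (bas \<tau>)))"
    unfolding \<Gamma>[symmetric] \<Gamma>0_def
    using preparation_mapD(4)[OF m0.prep _ transfer_mem_vspan[OF mem]] by simp
  finally have "\<Gamma>0 (transfer (R (bas \<tau>)) - R (transfer (bas \<tau>))) = 0"
    by (simp add: linear_diff[OF linear_\<Gamma>0])
  moreover have "transfer (R (bas \<tau>)) - R (transfer (bas \<tau>)) \<in> vspan TT"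
    by (intro subspace_diff subspace_vspan transfer_mem_vspan preparation_mapD(2)[OF m0.prep] mem)
  ultimately show ?thesis
    using recentring_injective unfolding \<Gamma>0_def by fastforce
qed

lemma model_eq_and_recentring_eq:
  assumes "\<tau> \<in> TT"
  shows "P1 x (bas \<tau>) = P0 x (transfer (bas \<tau>)) \<and> \<Gamma>0 (transfer (bas \<tau>)) = \<Gamma>1 (bas \<tau>)"
  using assms
proof (induction rule: TT_induct_noise)
  case (X k)
  show ?case
    by (simp add: transfer_bas contract_hat_XT \<Gamma>0_bas \<Gamma>1_bas contract_coact_XT fun_eq_iff
        prepared_modelD(3)[OF m0.model] prepared_modelD(3)[OF m1.model])
next
  case Xi0
  show ?case
    by (simp add: transfer_bas contract_hat_noise \<Gamma>0_bas \<Gamma>1_bas contract_coact_noise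
        prepared_modelD(4)[OF m0.model] prepared_modelD(4)[OF m1.model])
next
  case Xi1
  show ?case
    by (simp add: transfer_bas contract_hat_noise \<Gamma>0_bas \<Gamma>1_bas contract_coact_noise
        prepared_modelD(5)[OF m0.model] prepared_modelD(5)[OF m1.model])
next
  case (add \<sigma> \<tau>)
  have transfer: "transfer (bas (\<sigma> + \<tau>)) = transfer (bas \<sigma>) * transfer (bas \<tau>)"
    by (simp add: transfer_bas hat_coact_tree_add contract_char_times)
  have TT: "\<sigma> \<in> TT" "\<tau> \<in> TT" "root_noises \<sigma> + root_noises \<tau> \<le> 1"
    using add(1) by (simp_all add: add_mem_TT_iff)
  have "P1 x (bas (\<sigma> + \<tau>)) y = P0 x (transfer (bas (\<sigma> + \<tau>))) y" for y
  proof -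
    \<comment> \<open>\<open>transfer\<close> does not increase the number of noises at the root, so
      products of trees from the two factors remain in \<open>TT\<close>.\<close>
    have "P0 x (transfer (bas \<sigma>) * transfer (bas \<tau>)) y = P0 x (transfer (bas \<sigma>)) y * P0 x (transfer (bas \<tau>)) y"
      using contract_hat_mem_vspan[OF TT(1)] contract_hat_mem_vspan[OF TT(2)] unfolding transfer_bas
      by (rule m0.mult) (use TT(3) in \<open>auto simp: add_mem_TT_iff\<close>)
    then show ?thesis
      using add(2,3) by (simp add: transfer prepared_modelD(2)[OF m1.model add(1)])
  qed
  moreover have "\<Gamma>0 (transfer (bas (\<sigma> + \<tau>))) = \<Gamma>1 (bas (\<sigma> + \<tau>))"
    using add(2,3) by (simp add: transfer \<Gamma>0_times \<Gamma>1_bas coact_tree_add contract_char_times)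
  ultimately show ?case by blast
next
  case (I a \<tau>)
  let ?v = "transfer (bas \<tau>)" and ?c = "deg \<alpha> 1 (IT a \<tau>)"
  have R\<tau>: "R (bas \<tau>) \<in> vspan (insert \<tau> {\<sigma>\<in>TT. nnoise \<sigma> < nnoise \<tau>})"
    by (rule preparation_mapD(3)[OF m0.prep I(1)])
  \<comment> \<open>By linearity it suffices to treat \<tau> and trees with fewer noises, the ones
    covered by the induction hypotheses.\<close>
  have "\<Gamma>0 (transfer (R (bas \<tau>))) = \<Gamma>1 (R (bas \<tau>))"
    by (rule linear_eq_on_vspan[OF linear_comp[OF linear_transfer linear_\<Gamma>0] linear_\<Gamma>1 _ R\<tau>])
      (use I in auto)
  then have comm: "transfer (R (bas \<tau>)) = R ?v"
    using I(1,2) by (intro commute_transfer) auto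
  \<comment> \<open>The hypotheses give \<open>P0 x\<close> after \<open>transfer\<close> after
    \<open>R\<close>; commutation moves \<open>R\<close> next to \<open>P0 x\<close>, the form in
    which it enters the recursion for planted trees.\<close>
  have model: "P1 x (R (bas \<tau>)) = P0 x (R ?v)"
  proof
    fix y
    have "P1 x (R (bas \<tau>)) y = P0 x (transfer (R (bas \<tau>))) y"
      by (rule linear_eq_on_vspan[OF m1.lin linear_comp[OF linear_transfer m0.lin] _ R\<tau>])
        (use I in auto)
    then show "P1 x (R (bas \<tau>)) y = P0 x (R ?v) y" by (simp add: comm)
  qed
  have v: "?v \<in> vspan TT"
    by (intro transfer_mem_vspan bas_mem_vspan I)
  have dconv: "dconv b K (P1 x (R (bas \<tau>))) y = lin_ext (\<lambda>\<sigma>. dconv b K (P0 x (R (bas \<sigma>))) y) ?v" for b y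
    unfolding model by (rule m0.dconv_eq_lin_ext[OF v])
  \<comment> \<open>One cut-off, independent of \<sigma>, lies below all the 0-degrees that occur,
    as both lemmas on \<open>hat_graft\<close> require.\<close>
  have keys: "\<sigma> \<in> TT" "?c \<le> deg \<alpha> 0 (IT a \<sigma>)" if "\<sigma> \<in> Poly_Mapping.keys ?v" for \<sigma>
    using contract_hat_mem_vspan[OF I(1), of x \<psi>0 \<alpha>] that by (auto simp: transfer_bas mem_vspan_iff deg_IT)
  have transfer: "transfer (bas (IT a \<tau>)) = lin_ext (hat_graft \<alpha> \<psi>0 a ?c) ?v"
    unfolding transfer_bas by (rule contract_hat_IT)
  have "P1 x (bas (IT a \<tau>)) y = P0 x (transfer (bas (IT a \<tau>))) y" for y
  proof -
    have "P0 x (transfer (bas (IT a \<tau>))) y = lin_ext (\<lambda>\<sigma>. dconv a K (P0 x (R (bas \<sigma>))) y -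
        (\<Sum>k | real (mabs k) < ?c. (mpow (y - x) k / mfact k) *\<^sub>R dconv (a + k) K (P0 x (R (bas \<sigma>))) x)) ?v"
      unfolding transfer lin_ext_compose[OF m0.lin]
      by (rule lin_ext_cong[OF refl]) (simp add: model_hat_graft keys del: One_nat_def)
    also have "\<dots> = P1 x (bas (IT a \<tau>)) y"
      unfolding lin_ext_fun_diff lin_ext_fun_sum lin_ext_fun_scaleR dconv[symmetric]
      by (simp add: prepared_modelD(6)[OF m1.model I(1)])
    finally show ?thesis by simp
  qed
  moreover have "\<Gamma>0 (transfer (bas (IT a \<tau>))) = \<Gamma>1 (bas (IT a \<tau>))"
  proof -
    \<comment> \<open>On planted symbols the second character is the first one composed with
      \<open>transfer\<close>; this matches the coefficients of the two recentrings.\<close>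
    have \<psi>: "\<psi>1 b \<tau> = lin_ext (\<psi>0 b) ?v" for b
      using dconv[of b x] by (simp add: \<psi>0_def[abs_def] \<psi>1_def lin_ext_fun_uminus)
    have "\<Gamma>0 (transfer (bas (IT a \<tau>))) = lin_ext (\<lambda>\<sigma>. graft a (\<Gamma>0 (bas \<sigma>)) +
        (\<Sum>k | real (mabs k) < ?c. (\<psi>0 (a + k) \<sigma> *\<^sub>R ((1 / mfact k) *\<^sub>R shifted_monomial x k)))) ?v"
      unfolding transfer lin_ext_compose[OF linear_\<Gamma>0]
      by (rule lin_ext_cong[OF refl]) (simp add: \<Gamma>0_hat_graft keys del: One_nat_def)
    also have "\<dots> = graft a (\<Gamma>0 ?v) + (\<Sum>k | real (mabs k) < ?c. (\<psi>1 (a + k) \<tau> *\<^sub>R ((1 / mfact k) *\<^sub>R shifted_monomial x k)))"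
      unfolding lin_ext_fun_add lin_ext_fun_sum lin_ext_fun_scaleR_left \<psi>
        linear_eq_lin_ext[OF linear_comp[OF linear_\<Gamma>0 linear_graft[of a]], of ?v, symmetric] ..
    also have "\<dots> = \<Gamma>1 (bas (IT a \<tau>))"
      using I(2) by (simp add: \<Gamma>1_bas contract_coact_IT)
    finally show ?thesis .
  qed
  ultimately show ?case by blast
qed

text \<open>The identity for \<open>P1 x\<close> carries over to \<open>P1 x\<close> after
  \<open>R\<close> by commuting \<open>R\<close> with \<open>transfer\<close> once more, now that
  the premises hold for every tree.\<close>

lemma prepared_model_eq:
  assumes "v \<in> vspan TT"
  shows "P1 x (R v) y = P0 x (R (transfer v)) y"
proof (rule linear_eq_on_vspan[OF linear_comp[OF linear_R m1.lin]
      linear_comp[OF linear_comp[OF linear_transfer linear_R] m0.lin] _ assms])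
  fix \<tau> :: "'d tree" assume \<tau>: "\<tau> \<in> TT"
  have R\<tau>: "R (bas \<tau>) \<in> vspan TT"
    by (intro preparation_mapD(2)[OF m0.prep] bas_mem_vspan \<tau>)
  have "\<Gamma>0 (transfer (R (bas \<tau>))) = \<Gamma>1 (R (bas \<tau>))"
    by (rule linear_eq_on_vspan[OF linear_comp[OF linear_transfer linear_\<Gamma>0] linear_\<Gamma>1 _ R\<tau>])
      (simp add: model_eq_and_recentring_eq)
  then have comm: "transfer (R (bas \<tau>)) = R (transfer (bas \<tau>))"
    using \<tau> by (intro commute_transfer) (simp_all add: model_eq_and_recentring_eq)
  have "P1 x (R (bas \<tau>)) y = P0 x (transfer (R (bas \<tau>))) y"
    by (rule linear_eq_on_vspan[OF m1.lin linear_comp[OF linear_transfer m0.lin] _ R\<tau>])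
      (simp add: model_eq_and_recentring_eq)
  then show "P1 x (R (bas \<tau>)) y = P0 x (R (transfer (bas \<tau>))) y" by (simp add: comm)
qed

lemma recentring_character_eq: "recentring_character K (P0 x \<circ> R) x = lin_ext (tree_char x \<psi>0)"
  by (simp add: recentring_character_def tree_char_def \<psi>0_def)

end

theorem proposition3p8:
  fixes \<alpha> :: real
    and rl :: "'d::finite rule"
    and R :: "('d tree \<Rightarrow>\<^sub>0 real) \<Rightarrow> 'd tree \<Rightarrow>\<^sub>0 real"
    and K \<xi> \<delta>\<xi> :: "'d point \<Rightarrow> real"
    and P0 P1 :: "'d point \<Rightarrow> ('d tree \<Rightarrow>\<^sub>0 real) \<Rightarrow> 'd point \<Rightarrow> real"
  assumes "spde_rule rl" and "normal_rule rl" and "subcritical_rule \<alpha> rl" and "complete_rule \<alpha> rl"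
    and "preparation_map \<alpha> rl R"
    and "truncated_heat_kernel K"
    and "smooth_on UNIV \<xi>" and "smooth_on UNIV \<delta>\<xi>"
    and "prepared_model \<alpha> R K \<xi> \<delta>\<xi> 0 P0"
    and "prepared_model \<alpha> R K \<xi> \<delta>\<xi> 1 P1"
  shows "\<forall>v\<in>vspan (T1_of rl). \<forall>x.
    (P1 x \<circ> R) v =
      tensor_eval (P0 x \<circ> R) (recentring_character K (P0 x \<circ> R) x) (hat_coact \<alpha> v)"
proof (intro ballI allI ext)
  fix v x y assume "v \<in> vspan (T1_of rl)"
  then have v: "v \<in> vspan TT" by (rule mem_vspan_mono) (rule T1_of_subset_TT)
  interpret model_pair \<alpha> rl R K \<xi> \<delta>\<xi> P0 P1 x
    by unfold_locales (use assms in auto)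
  have "linear (\<lambda>v. (P0 x \<circ> R) v y)" for y
    using linear_comp[OF linear_R m0.lin] by simp
  then have "tensor_eval (P0 x \<circ> R) (recentring_character K (P0 x \<circ> R) x) (hat_coact \<alpha> v) y =
      (P0 x \<circ> R) (transfer v) y"
    unfolding recentring_character_eq transfer_def by (rule tensor_eval_eq_contract)
  then show "(P1 x \<circ> R) v y =
      tensor_eval (P0 x \<circ> R) (recentring_character K (P0 x \<circ> R) x) (hat_coact \<alpha> v) y"
    by (simp add: prepared_model_eq[OF v])
qed

end
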